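(* Let $k$ be a perfect field of characteristic $p>0$, let $n\ge 1$ and $\mathbf t=(t_1,\ldots,t_n)$ be indeterminates, and let $K$ be the field of fractions of $k[[\mathbf t]]$. Let $A(\mathbf t,y)$ be a nonzero polynomial in $k[\mathbf t,y]$ and let $f\in k[[\mathbf t]]$ satisfy $A(\mathbf t,f)=0$. Set $$C:=\mathrm{NP}(A)+(-1,0]^{n+1}\subset\mathbb R^{n+1}.$$ Then there exists a $k$-vector space $W\subset K$ of dimension at most $$\mathrm{Card}(C\cap\mathbb N^{n+1})$$ that contains $f$ and that is closed under the action of $\Omega_n$.
   Context: $\mathbb N=\{0,1,2,\ldots\}$. For $\mathbf i=(i_1,\ldots,i_n)$ write $\mathbf t^{\mathbf i}=t_1^{i_1}\cdots t_n^{i_n}$. Newton polytope: for $A=\sum_{\mathbf i\in\mathbb N^n,\,j\in\mathbb N}a_{\mathbf i,j}\mathbf t^{\mathbf i}y^j\in k[\mathbf t,y]$, $\mathrm{NP}(A)$ is the convex hull in $\mathbb R^{n+1}$ of the tuples $(\mathbf i,j)$ with $a_{\mathbf i,j}\ne 0$. The plus sign in the definition of $C$ is the Minkowski sum of subsets of $\mathbb R^{n+1}$. Section operators: let $\mathsf F:K\to K$, $x\mapsto x^p$, be the Frobenius map (injective), and let $K^{\langle p\rangle}=\mathsf F(K)$. Since $k$ is perfect, $K$ is a $K^{\langle p\rangle}$-vector space of dimension $p^n$ with basis $\{\mathbf t^{\mathbf r}:\mathbf r\in\{0,\ldots,p-1\}^n\}$, so each $g\in K$ has a unique expansion $g=\sum_{\mathbf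 r\in\{0,\ldots,p-1\}^n}\mathbf t^{\mathbf r}g_{\mathbf r}$ with $g_{\mathbf r}\in K^{\langle p\rangle}$. For $\mathbf r\in\{0,\ldots,p-1\}^n$ the section operator $S_{\mathbf r}:K\to K$ is $S_{\mathbf r}(g):=\mathsf F^{-1}(g_{\mathbf r})$. For a power series $g=\sum_{\mathbf i}a(\mathbf i)\mathbf t^{\mathbf i}$ one has $S_{\mathbf r}(g)=\sum_{\mathbf i}a(pi_1+r_1,\ldots,pi_n+r_n)^{1/p}\,\mathbf t^{\mathbf i}$. $\Omega_n$ is the monoid generated by all $S_{\mathbf r}$, $\mathbf r\in\{0,\ldots,p-1\}^n$, under composition. *)

theory Defs
  imports
    "HOL-Analysis.Analysis"
    "HOL-Library.Poly_Mapping"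
    "HOL-Computational_Algebra.Fraction_Field"
begin

text \<open>
  The variables \<open>t\<^sub>s\<close> are indexed by the elements \<open>s\<close> of the finite type \<^typ>\<open>'n\<close>, so
  \<open>n = CARD('n) \<ge> 1\<close>, and multi-indices are elements of \<^typ>\<open>nat ^ 'n\<close>.
\<close>

typedef (overloaded) ('k, 'n) mfps = "UNIV :: (nat ^ 'n \<Rightarrow> 'k::zero) set"
  morphisms mfps_nth Abs_mfps ..

setup_lifting type_definition_mfps

lemma mfps_eqI: "(\<And>m. mfps_nth f m = mfps_nth g m) \<Longrightarrow> f = g"
  by (simp add: mfps_nth_inject [symmetric] fun_eq_iff)

lemma finite_add_decomp: "finite {(i, j). i + j = (m :: nat ^ 'n)}"
proof -
  have fin: "finite {i. \<forall>s. i $ s \<le> m $ s}"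
  proof -
    have "finite ((\<lambda>i. \<chi> s. i s) ` (PiE (UNIV :: 'n set) (\<lambda>s. {..m $ s})))"
      by (intro finite_imageI finite_PiE) auto
    moreover have "i \<in> (\<lambda>i. \<chi> s. i s) ` (PiE (UNIV :: 'n set) (\<lambda>s. {..m $ s}))"
      if "\<forall>s. i $ s \<le> m $ s" for i
      using that by (intro image_eqI [of _ _ "($) i"]) (auto simp: vec_eq_iff)
    ultimately show ?thesis
      by (elim finite_subset [rotated]) blast
  qed
  have "{(i, j). i + j = m} \<subseteq> {i. \<forall>s. i $ s \<le> m $ s} \<times> {i. \<forall>s. i $ s \<le> m $ s}"
    by auto
  then show ?thesis
    using finite_cartesian_product [OF fin fin] by (rule finite_subset)
qed

instantiation mfps :: (comm_ring_1, finite) comm_ring_1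
begin

lift_definition zero_mfps :: "('a, 'b) mfps" is "\<lambda>_. 0" .
lift_definition one_mfps :: "('a, 'b) mfps" is "\<lambda>m. if m = 0 then 1 else 0" .
lift_definition plus_mfps :: "('a, 'b) mfps \<Rightarrow> ('a, 'b) mfps \<Rightarrow> ('a, 'b) mfps"
  is "\<lambda>f g m. f m + g m" .
lift_definition minus_mfps :: "('a, 'b) mfps \<Rightarrow> ('a, 'b) mfps \<Rightarrow> ('a, 'b) mfps"
  is "\<lambda>f g m. f m - g m" .
lift_definition uminus_mfps :: "('a, 'b) mfps \<Rightarrow> ('a, 'b) mfps"
  is "\<lambda>f m. - f m" .
lift_definition times_mfps :: "('a, 'b) mfps \<Rightarrow> ('a, 'b) mfps \<Rightarrow> ('a, 'b) mfps"
  is "\<lambda>f g m. \<Sum>(i, j)\<in>{(i, j). i + j = m}. f i * g j" .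

instance
proof
  fix f g h :: "('a, 'b) mfps"
  show "f + g + h = f + (g + h)" "f + g = g + f" "0 + f = f" "- f + f = 0" "f - g = f + - g"
    by (transfer; simp add: fun_eq_iff algebra_simps)+
  show "f * g = g * f"
  proof (transfer, rule ext)
    fix f g :: "nat ^ 'b \<Rightarrow> 'a" and m
    show "(\<Sum>(i, j)\<in>{(i, j). i + j = m}. f i * g j) = (\<Sum>(i, j)\<in>{(i, j). i + j = m}. g i * f j)"
      by (rule sum.reindex_bij_witness [of _ prod.swap prod.swap])
        (auto simp: add.commute mult.commute)
  qed
  show "(f + g) * h = f * h + g * h"
    by transfer (simp add: fun_eq_iff distrib_right case_prod_unfold sum.distrib)
  show "1 * f = f"
  proof (transfer, rule ext)
    fix f :: "nat ^ 'b \<Rightarrow> 'a" and m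
    have "(\<Sum>(i, j)\<in>{(i, j). i + j = m}. (if i = 0 then 1 else 0) * f j)
        = (\<Sum>(i, j)\<in>{(0 :: nat ^ 'b, m)}. (if i = 0 then 1 else 0) * f j)"
      by (rule sum.mono_neutral_right) (auto simp: finite_add_decomp split: if_splits)
    then show "(\<Sum>(i, j)\<in>{(i, j). i + j = m}. (if i = 0 then 1 else 0) * f j) = f m"
      by simp
  qed
  show "(0 :: ('a, 'b) mfps) \<noteq> 1"
    by transfer (auto simp: fun_eq_iff)
  show "f * g * h = f * (g * h)"
  proof (transfer, rule ext)
    fix f g h :: "nat ^ 'b \<Rightarrow> 'a" and m
    let ?D = "\<lambda>m :: nat ^ 'b. {(i, j). i + j = m}"
    have "(\<Sum>(a, c)\<in>?D m. (\<Sum>(i, j)\<in>?D a. f i * g j) * h c)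
        = (\<Sum>x\<in>?D m. \<Sum>y\<in>?D (fst x). f (fst y) * g (snd y) * h (snd x))"
      by (simp add: case_prod_unfold sum_distrib_right)
    also have "\<dots> = (\<Sum>(x, y)\<in>Sigma (?D m) (\<lambda>x. ?D (fst x)). f (fst y) * g (snd y) * h (snd x))"
      by (rule sum.Sigma) (auto simp: finite_add_decomp)
    also have "\<dots> = (\<Sum>(x, y)\<in>Sigma (?D m) (\<lambda>x. ?D (snd x)). f (fst x) * (g (fst y) * h (snd y)))"
      by (rule sum.reindex_bij_witness
            [of _ "\<lambda>((i, _), (j, c)). ((i + j, c), (i, j))" "\<lambda>((_, c), (i, j)). ((i, j + c), (j, c))"])
        (auto simp: algebra_simps)
    also have "\<dots> = (\<Sum>x\<in>?D m. \<Sum>y\<in>?D (snd x). f (fst x) * (g (fst y) * h (snd y)))"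
      by (rule sum.Sigma [symmetric]) (auto simp: finite_add_decomp)
    also have "\<dots> = (\<Sum>(i, b)\<in>?D m. f i * (\<Sum>(j, c)\<in>?D b. g j * h c))"
      by (simp add: case_prod_unfold sum_distrib_left)
    finally show "(\<Sum>(a, c)\<in>?D m. (\<Sum>(i, j)\<in>?D a. f i * g j) * h c)
        = (\<Sum>(i, b)\<in>?D m. f i * (\<Sum>(j, c)\<in>?D b. g j * h c))" .
  qed
qed

end

text \<open>Any two nonempty sets of multi-indices have elements whose sum decomposes uniquely
  (minimise the coordinates one after the other).\<close>

lemma unique_sum_exists:
  fixes X Y :: "(nat ^ 'n) set"
  assumes "X \<noteq> {}" "Y \<noteq> {}"
  shows "\<exists>u\<in>X. \<exists>v\<in>Y. \<forall>i\<in>X. \<forall>j\<in>Y. i + j = u + v \<longrightarrow> i = u \<and> j = v"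
proof -
  have ex_min_coord: "\<exists>z\<in>Z. \<forall>z'\<in>Z. z $ s \<le> z' $ s" if "Z \<noteq> {}" for Z :: "(nat ^ 'n) set" and s
    using that ex_has_least_nat [of "\<lambda>z. z \<in> Z" _ "\<lambda>z. z $ s"] by blast
  have "\<exists>u\<in>X. \<exists>v\<in>Y. \<forall>i\<in>X. \<forall>j\<in>Y. i + j = u + v \<longrightarrow> (\<forall>s\<in>S. i $ s = u $ s \<and> j $ s = v $ s)"
    if "finite S" for S :: "'n set"
    using that assms
  proof (induction S arbitrary: X Y rule: finite_induct)
    case empty
    then show ?case by auto
  next
    case (insert s S)
    define X' where "X' = {x\<in>X. \<forall>x'\<in>X. x $ s \<le> x' $ s}"
    define Y' where "Y' = {y\<in>Y. \<forall>y'\<in>Y. y $ s \<le> y' $ s}"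
    have "X' \<noteq> {}"
      using ex_min_coord [OF insert.prems(1), of s] unfolding X'_def by blast
    moreover have "Y' \<noteq> {}"
      using ex_min_coord [OF insert.prems(2), of s] unfolding Y'_def by blast
    ultimately obtain u v where uv: "u \<in> X'" "v \<in> Y'"
      and *: "\<And>i j. i \<in> X' \<Longrightarrow> j \<in> Y' \<Longrightarrow> i + j = u + v \<Longrightarrow> \<forall>s\<in>S. i $ s = u $ s \<and> j $ s = v $ s"
      using insert.IH [of X' Y'] by meson
    have "\<forall>s\<in>insert s S. i $ s = u $ s \<and> j $ s = v $ s"
      if ij: "i \<in> X" "j \<in> Y" "i + j = u + v" for i j
    proof -
      have "i $ s + j $ s = u $ s + v $ s"
        using ij(3) by (metis vector_add_component)
      moreover have "u $ s \<le> i $ s" "v $ s \<le> j $ s"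
        using uv ij unfolding X'_def Y'_def by auto
      ultimately have eq: "i $ s = u $ s" "j $ s = v $ s"
        by auto
      then have "i \<in> X'" "j \<in> Y'"
        using uv ij unfolding X'_def Y'_def by auto
      with * ij eq show ?thesis by blast
    qed
    moreover have "u \<in> X" "v \<in> Y"
      using uv unfolding X'_def Y'_def by auto
    ultimately show ?case by blast
  qed
  from this [of UNIV] show ?thesis
    by (simp add: vec_eq_iff all_conj_distrib)
qed

instance mfps :: (idom, finite) idom
proof
  fix f g :: "('a, 'b) mfps"
  assume "f \<noteq> 0" "g \<noteq> 0"
  then have "{m. mfps_nth f m \<noteq> 0} \<noteq> {}" "{m. mfps_nth g m \<noteq> 0} \<noteq> {}"
    by (auto intro!: mfps_eqI simp: zero_mfps.rep_eq)
  from unique_sum_exists [OF this] obtain u v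
    where uv: "mfps_nth f u \<noteq> 0" "mfps_nth g v \<noteq> 0"
      and *: "\<And>i j. mfps_nth f i \<noteq> 0 \<Longrightarrow> mfps_nth g j \<noteq> 0 \<Longrightarrow> i + j = u + v \<Longrightarrow> i = u \<and> j = v"
    by blast
  have "mfps_nth (f * g) (u + v) = (\<Sum>(i, j)\<in>{(i, j). i + j = u + v}. mfps_nth f i * mfps_nth g j)"
    by (simp add: times_mfps.rep_eq)
  also have "\<dots> = (\<Sum>(i, j)\<in>{(u, v)}. mfps_nth f i * mfps_nth g j)"
    by (rule sum.mono_neutral_right) (use * in \<open>auto simp: finite_add_decomp\<close>)
  finally have "mfps_nth (f * g) (u + v) \<noteq> 0"
    using uv by simp
  then show "f * g \<noteq> 0"
    by (auto simp: zero_mfps.rep_eq)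
qed

lift_definition mfps_const :: "'k::comm_ring_1 \<Rightarrow> ('k, 'n::finite) mfps"
  is "\<lambda>c m. if m = 0 then c else 0" .

lift_definition mfps_var :: "'n::finite \<Rightarrow> ('k::comm_ring_1, 'n) mfps"
  is "\<lambda>s m. if m = axis s 1 then 1 else 0" .

definition mfps_monom :: "nat ^ 'n::finite \<Rightarrow> ('k::comm_ring_1, 'n) mfps"
  where "mfps_monom i = (\<Prod>s\<in>UNIV. mfps_var s ^ (i $ s))"

lemma mfps_const_add: "mfps_const (a + b) = mfps_const a + mfps_const b"
  by transfer (auto simp: fun_eq_iff)

lemma mfps_const_1: "mfps_const 1 = 1"
  by transfer (auto simp: fun_eq_iff)

lemma mfps_const_mult: "mfps_const (a * b) = mfps_const a * mfps_const b"
proof (transfer, rule ext)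
  fix a b :: 'a and m :: "nat ^ 'b"
  have "(\<Sum>(i, j)\<in>{(i, j). i + j = m}. (if i = 0 then a else 0) * (if j = 0 then b else 0))
      = (\<Sum>(i, j)\<in>{(0 :: nat ^ 'b, m)}. (if i = 0 then a else 0) * (if j = 0 then b else 0))"
    by (rule sum.mono_neutral_right) (auto simp: finite_add_decomp split: if_splits)
  then show "(if m = 0 then a * b else 0) =
    (\<Sum>(i, j)\<in>{(i, j). i + j = m}. (if i = 0 then a else 0) * (if j = 0 then b else 0))"
    by simp
qed

text \<open>A polynomial \<open>A(t, y)\<close> is the finitely supported family of its coefficients \<open>a\<^sub>i\<^sub>,\<^sub>j\<close>.\<close>

type_synonym ('k, 'n) mpoly_y = "((nat ^ 'n) \<times> nat) \<Rightarrow>\<^sub>0 'k"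

definition eval_y :: "('k::comm_ring_1, 'n::finite) mpoly_y \<Rightarrow> ('k, 'n) mfps \<Rightarrow> ('k, 'n) mfps"
  where "eval_y A f =
    (\<Sum>(i, j)\<in>Poly_Mapping.keys A. mfps_const (Poly_Mapping.lookup A (i, j)) * mfps_monom i * f ^ j)"

text \<open>The space \<open>\<real>\<^bsup>n+1\<^esup>\<close> is rendered as \<^typ>\<open>(real ^ 'n) \<times> real\<close>.\<close>

definition newton_polytope :: "('k::zero, 'n::finite) mpoly_y \<Rightarrow> ((real ^ 'n) \<times> real) set"
  where "newton_polytope A = convex hull ((\<lambda>(i, j). (\<chi> s. real (i $ s), real j)) ` Poly_Mapping.keys A)"

definition half_open_cube :: "((real ^ 'n) \<times> real) set"
  where "half_open_cube = {x. (\<forall>s. fst x $ s \<in> {-1<..0}) \<and> snd x \<in> {-1<..0}}"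

definition nat_points :: "((real ^ 'n) \<times> real) set"
  where "nat_points = {x. (\<forall>s. fst x $ s \<in> \<nat>) \<and> snd x \<in> \<nat>}"

type_synonym ('k, 'n) mfps_frac = "('k, 'n) mfps fract"

definition of_mfps :: "('k::idom, 'n::finite) mfps \<Rightarrow> ('k, 'n) mfps_frac"
  where "of_mfps f = Fract f 1"

lemma of_mfps_add: "of_mfps (f + g) = of_mfps f + of_mfps g"
  by (simp add: of_mfps_def)

lemma of_mfps_mult: "of_mfps (f * g) = of_mfps f * of_mfps g"
  by (simp add: of_mfps_def)

lemma of_mfps_1: "of_mfps 1 = 1"
  by (simp add: of_mfps_def One_fract_def)

definition kscale :: "'k::field \<Rightarrow> ('k, 'n::finite) mfps_frac \<Rightarrow> ('k, 'n) mfps_frac"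
  where "kscale c x = of_mfps (mfps_const c) * x"

interpretation kspace: vector_space "kscale :: 'k::field \<Rightarrow> ('k, 'n::finite) mfps_frac \<Rightarrow> _"
proof
  fix a b :: 'k and x y :: "('k, 'n) mfps_frac"
  show "kscale a (x + y) = kscale a x + kscale a y"
    by (simp only: kscale_def distrib_left)
  show "kscale (a + b) x = kscale a x + kscale b x"
    by (simp only: kscale_def mfps_const_add of_mfps_add distrib_right)
  show "kscale a (kscale b x) = kscale (a * b) x"
    by (simp only: kscale_def mfps_const_mult of_mfps_mult mult.assoc)
  show "kscale 1 x = x"
    by (simp only: kscale_def mfps_const_1 of_mfps_1 mult_1_left)
qed

definition frob :: "('k::field, 'n::finite) mfps_frac \<Rightarrow> ('k, 'n) mfps_frac"
  where "frob x = x ^ CHAR('k)"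

definition digits :: "nat \<Rightarrow> (nat ^ 'n) set"
  where "digits p = {r. \<forall>s. r $ s < p}"

text \<open>
  \<open>frob_coords g\<close> is the family \<open>(g\<^sub>r)\<close>, extended by 0 to all multi-indices \<open>r\<close> so that it is
  determined by \<open>g\<close>.  The description is meaningful when \<open>'k\<close> is perfect of positive
  characteristic: then the \<open>t\<^sup>r\<close> with all entries of \<open>r\<close> less than the characteristic form a basis
  of the fraction field over the image of Frobenius.
\<close>

definition frob_coords :: "('k::field, 'n::finite) mfps_frac \<Rightarrow> nat ^ 'n \<Rightarrow> ('k, 'n) mfps_frac"
  where "frob_coords g = (THE G.
      (\<forall>r\<in>digits CHAR('k). G r \<in> range frob) \<and>
      (\<forall>r. r \<notin> digits CHAR('k) \<longrightarrow> G r = 0) \<and>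
      g = (\<Sum>r\<in>digits CHAR('k). of_mfps (mfps_monom r) * G r))"

definition section_op :: "nat ^ 'n::finite \<Rightarrow> ('k::field, 'n) mfps_frac \<Rightarrow> ('k, 'n) mfps_frac"
  where "section_op r g = inv frob (frob_coords g r)"

inductive_set section_monoid :: "(('k::field, 'n::finite) mfps_frac \<Rightarrow> ('k, 'n) mfps_frac) set" where
  id: "id \<in> section_monoid"
| gen: "r \<in> digits CHAR('k) \<Longrightarrow> section_op r \<in> section_monoid"
| comp: "\<phi> \<in> section_monoid \<Longrightarrow> \<psi> \<in> section_monoid \<Longrightarrow> \<phi> \<circ> \<psi> \<in> section_monoid"

end

theory Submission
  imports Defs "HOL-Computational_Algebra.Computational_Algebra"
begin

text \<open>
  Write \<open>y = f + T\<close> in \<open>K[[T]]\<close> and \<open>A(t, f + T) = T\<^sup>m U\<close> with \<open>U(0) \<noteq> 0\<close>. The space \<open>W\<close> consists of the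
  residues at \<open>T = 0\<close> of \<open>P(t, y) / A(t, y)\<close>, where \<open>P\<close> runs over the polynomials supported on the
  lattice points of \<open>C\<close>. Expanding \<open>P A\<^bsup>p-1\<^esup> = \<Sum> t\<^sup>r y\<^sup>s Q\<^sub>r\<^sub>,\<^sub>s\<^sup>p\<close> gives
  \<open>P / A = \<Sum> t\<^sup>r y\<^sup>s (Q\<^sub>r\<^sub>,\<^sub>s / A)\<^sup>p\<close>; only \<open>s = p - 1\<close> contributes to the residue, so the section of
  index \<open>r\<close> maps the residue of \<open>P / A\<close> to that of \<open>Q\<^sub>r\<^sub>,\<^sub>p\<^sub>-\<^sub>1 / A\<close>. The support of each \<open>Q\<^sub>r\<^sub>,\<^sub>s\<close> lies in \<open>C\<close>
  because \<open>C + (p - 1) NP(A) = p NP(A) + (-1, 0]\<^bsup>n+1\<^esup>\<close>.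

  The order \<open>m\<close> of the root may be divisible by \<open>p\<close>, so \<open>y A\<^sub>y / A\<close> need not have residue a nonzero
  multiple of \<open>f\<close>. Instead let \<open>m = q m'\<close> with \<open>q = p\<^sup>e\<close> and \<open>p\<close> prime to \<open>m'\<close>, and let \<open>H\<close> be the Hasse
  derivative of \<open>A\<close> of order \<open>q\<close> in \<open>y\<close>. Then \<open>y\<^sup>q H\<close> is supported on the support of \<open>A\<close>, and
  \<open>y\<^bsup>q-1\<^esup> y\<^sup>q H / A\<close> has residue \<open>m' f\<^sup>q\<close>. Applying the sections of index \<open>r = 0\<close>, \<open>s = p - 1\<close> a total of
  \<open>e\<close> times turns \<open>y\<^bsup>q-1\<^esup> P / A\<close> into some \<open>Q / A\<close> with \<open>Q\<close> again supported on \<open>C\<close>, so \<open>f \<in> W\<close>.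
\<close>

section \<open>Frobenius and binomial coefficients in characteristic p\<close>

lemma CHAR_eq_if_injective_hom:
  fixes h :: "'a::comm_ring_1 \<Rightarrow> 'b::comm_ring_1"
  assumes "h 1 = 1" "\<And>x y. h (x + y) = h x + h y" "inj h"
  shows "CHAR('b) = CHAR('a)"
proof -
  have 0: "h 0 = 0"
    using assms(2) [of 0 0] by simp
  have "h (of_nat n) = of_nat n" for n
    by (induction n) (simp_all add: 0 assms)
  then show ?thesis
    by (intro CHAR_eqI) (metis 0 of_nat_CHAR, metis 0 assms(3) injD of_nat_eq_0_iff_char_dvd)
qed

text \<open>Splitting off the constant term, F = c + X G, gives F^p = c^p + X^p G^p by additivity of
  the p-th power. The coefficient of index n is thus reduced to one of index n - p of G^p.\<close>

lemma fps_nth_power_CHAR: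
  fixes F :: "'a::comm_ring_1 fps"
  assumes p: "prime CHAR('a)"
  shows "fps_nth (F ^ CHAR('a)) n =
    (if CHAR('a) dvd n then fps_nth F (n div CHAR('a)) ^ CHAR('a) else 0)"
proof (induction n arbitrary: F rule: less_induct)
  case (less n)
  let ?p = "CHAR('a)"
  have pos: "?p > 0"
    using p by (simp add: prime_gt_0_nat)
  have "F ^ ?p = (fps_const (fps_nth F 0) + fps_X * fps_shift 1 F) ^ ?p"
    by (intro arg_cong [of _ _ "\<lambda>G. G ^ CHAR('a)"] fps_ext) simp
  also have "\<dots> = fps_const (fps_nth F 0 ^ ?p) + fps_X ^ ?p * fps_shift 1 F ^ ?p"
    using p by (subst freshmans_dream) (simp_all add: power_mult_distrib fps_const_power)
  finally have eq: "fps_nth (F ^ ?p) n =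
      (if n = 0 then fps_nth F 0 ^ ?p else 0) +
      (if n < ?p then 0 else fps_nth (fps_shift 1 F ^ ?p) (n - ?p))"
    by (simp add: fps_X_power_mult_nth)
  show ?case
  proof (cases "n < ?p")
    case True
    then show ?thesis
      using eq by (auto dest: dvd_imp_le)
  next
    case False
    then have "fps_nth (F ^ ?p) n =
        (if ?p dvd n - ?p then fps_nth F ((n - ?p) div ?p + 1) ^ ?p else 0)"
      using eq pos less.IH [of "n - ?p" "fps_shift 1 F"] by simp
    then show ?thesis
      using False pos by (simp add: le_div_geq dvd_minus_self)
  qed
qed

lemma fps_nth_shifted_power:
  fixes c :: "'a::comm_ring_1"
  shows "fps_nth ((fps_const c + fps_X) ^ j) n = of_nat (j choose n) * c ^ (j - n)"
proof -
  have "(fps_const c + fps_X) ^ j = (\<Sum>k\<le>j. of_nat (j choose k) * fps_X ^ k * fps_const c ^ (j - k))"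
    by (subst add.commute) (rule binomial_ring)
  also have "\<dots> = (\<Sum>k\<le>j. fps_const (of_nat (j choose k) * c ^ (j - k)) * fps_X ^ k)"
    by (simp add: fps_of_nat [symmetric] fps_const_power mult_ac flip: fps_const_mult)
  finally show ?thesis
    by (cases "n \<le> j") (simp_all add: fps_sum_nth if_distrib sum.delta binomial_eq_0 cong: if_cong)
qed

text \<open>A case of Lucas's theorem. With q = p^e one has (1 + X)^(N + q) = (1 + X)^N (1 + X^q),
  so passing from N to N + q raises the coefficient of X^q by one, exactly as it raises the quotient
  by q.\<close>

lemma of_nat_choose_CHAR_power:
  assumes p: "prime CHAR('a::comm_ring_1)"
  shows "(of_nat (n choose (CHAR('a) ^ e)) :: 'a) = of_nat (n div CHAR('a) ^ e)"
proof (induction n rule: less_induct)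
  case (less n)
  define q where "q = CHAR('a) ^ e"
  have q: "q > 0"
    using p by (simp add: q_def prime_gt_0_nat)
  show ?case
  proof (cases "n < q")
    case True
    then show ?thesis
      by (simp add: q_def binomial_eq_0)
  next
    case False
    define N where "N = n - q"
    have n: "n = N + q"
      using False by (simp add: N_def)
    have "(1 + fps_X :: 'a fps) ^ n = (1 + fps_X) ^ N * (1 + fps_X ^ q)"
      using p freshmans_dream' [of q e "1 :: 'a fps" fps_X] by (simp add: n power_add q_def [symmetric])
    also have "\<dots> = (1 + fps_X) ^ N + fps_X ^ q * (1 + fps_X) ^ N"
      by (simp add: algebra_simps)
    finally have "fps_nth ((1 + fps_X :: 'a fps) ^ n) q =
        fps_nth ((1 + fps_X) ^ N) q + fps_nth ((1 + fps_X) ^ N) 0"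
      by (simp only: fps_add_nth fps_X_power_mult_nth) simp
    then have "(of_nat (n choose q) :: 'a) = of_nat (N choose q) + 1"
      using fps_nth_shifted_power [of "1::'a"] by (simp only: fps_const_1_eq_1) simp
    also have "\<dots> = of_nat (n div q)"
      using less.IH [of N] q by (simp add: n flip: q_def)
    finally show ?thesis
      by (simp add: q_def)
  qed
qed

section \<open>Monomials and coefficients in k[[t]]\<close>

definition mfps_single :: "nat ^ 'n::finite \<Rightarrow> 'k::comm_ring_1 \<Rightarrow> ('k, 'n) mfps"
  where "mfps_single i c = Abs_mfps (\<lambda>m. if m = i then c else 0)"

lemma mfps_nth_single: "mfps_nth (mfps_single i c) m = (if m = i then c else 0)"
  by (simp add: mfps_single_def Abs_mfps_inverse)

lemma mfps_nth_add: "mfps_nth (f + g) m = mfps_nth f m + mfps_nth g m"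
  by (simp add: plus_mfps.rep_eq)

lemma mfps_nth_0: "mfps_nth 0 m = 0"
  by (simp add: zero_mfps.rep_eq)

lemma mfps_nth_sum: "mfps_nth (sum F S) m = (\<Sum>x\<in>S. mfps_nth (F x) m)"
  by (induction S rule: infinite_finite_induct) (simp_all add: mfps_nth_add mfps_nth_0)

lemma mfps_nth_single_mult:
  "mfps_nth (mfps_single i c * f) m = (if \<forall>s. i $ s \<le> m $ s then c * mfps_nth f (m - i) else 0)"
proof -
  have "mfps_nth (mfps_single i c * f) m =
      (\<Sum>(a, b)\<in>{(a, b). a + b = m}. mfps_nth (mfps_single i c) a * mfps_nth f b)"
    by (simp add: times_mfps.rep_eq)
  also have "\<dots> = (\<Sum>(a, b)\<in>{(a, b). a + b = m \<and> a = i}. c * mfps_nth f b)"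
    by (rule sum.mono_neutral_cong_right)
      (auto simp: finite_add_decomp mfps_nth_single split: if_splits)
  also have "{(a, b). a + b = m \<and> a = i} = (if \<forall>s. i $ s \<le> m $ s then {(i, m - i)} else {})"
  proof (cases "\<forall>s. i $ s \<le> m $ s")
    case True
    then have "i $ s + b $ s = m $ s \<longleftrightarrow> b $ s = m $ s - i $ s" for b :: "nat ^ 'b" and s
      by (metis add_diff_cancel_left' le_add_diff_inverse)
    then have "i + b = m \<longleftrightarrow> b = m - i" for b
      by (simp add: vec_eq_iff)
    with True show ?thesis
      by auto
  next
    case False
    then have "i + b \<noteq> m" for b
      by auto
    with False show ?thesis
      by auto
  qed
  finally show ?thesis
    by (simp split: if_splits)
qed

lemma mfps_single_mult: "mfps_single i a * mfps_single j b = mfps_single (i + j) (a * b)"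
proof (rule mfps_eqI)
  fix m
  have "m = i + j \<longleftrightarrow> (\<forall>s. i $ s \<le> m $ s) \<and> m - i = j"
    by (auto simp: vec_eq_iff) (metis le_add_diff_inverse)
  then show "mfps_nth (mfps_single i a * mfps_single j b) m = mfps_nth (mfps_single (i + j) (a * b)) m"
    by (auto simp: mfps_nth_single_mult mfps_nth_single)
qed

lemma mfps_single_0_1: "mfps_single 0 1 = 1"
  by (rule mfps_eqI) (simp add: mfps_nth_single one_mfps.rep_eq)

lemma mfps_single_power: "mfps_single i a ^ n = mfps_single (\<chi> s. n * i $ s) (a ^ n)"
proof (induction n)
  case 0
  have "(\<chi> s. 0 * i $ s) = 0"
    by (simp add: vec_eq_iff)
  then show ?case
    by (simp add: mfps_single_0_1)
next
  case (Suc n)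
  have "i + (\<chi> s. n * i $ s) = (\<chi> s. Suc n * i $ s)"
    by (simp add: vec_eq_iff)
  with Suc show ?case
    by (simp add: mfps_single_mult)
qed

lemma mfps_var_eq_single: "mfps_var s = mfps_single (axis s 1) 1"
  by (rule mfps_eqI) (simp add: mfps_nth_single mfps_var.rep_eq)

lemma mfps_monom_eq_single: "mfps_monom i = mfps_single i 1"
proof -
  have *: "(\<Prod>s\<in>S. mfps_var s ^ (i $ s)) = mfps_single (\<chi> s. if s \<in> S then i $ s else 0) 1"
    if "finite S" for S
    using that
  proof induction
    case empty
    have "(\<chi> s. if s \<in> {} then i $ s else 0) = 0"
      by (simp add: vec_eq_iff)
    then show ?case
      by (simp add: mfps_single_0_1)
  next
    case (insert s S)
    have "(\<chi> s'. i $ s * axis s 1 $ s') + (\<chi> s'. if s' \<in> S then i $ s' else 0) =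
        (\<chi> s'. if s' \<in> insert s S then i $ s' else 0)"
      using insert.hyps by (auto simp: vec_eq_iff axis_def)
    then show ?case
      by (simp only: prod.insert [OF insert.hyps] insert.IH)
        (simp only: mfps_var_eq_single mfps_single_power power_one mfps_single_mult mult_1_left)
  qed
  show ?thesis
    using * [of UNIV] by (simp add: mfps_monom_def)
qed

lemma mfps_const_eq_single: "mfps_const c = mfps_single 0 c"
  by (rule mfps_eqI) (simp add: mfps_nth_single mfps_const.rep_eq)

lemma mfps_const_mult_monom: "mfps_const c * mfps_monom i = mfps_single i c"
  by (simp add: mfps_const_eq_single mfps_monom_eq_single mfps_single_mult)

lemma mfps_monom_add: "mfps_monom (i + j) = mfps_monom i * mfps_monom j"
  by (simp add: mfps_monom_eq_single mfps_single_mult)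

section \<open>Characteristic and p-th powers in k[[t]] and K\<close>

lemma CHAR_mfps [simp]: "CHAR(('k::comm_ring_1, 'n::finite) mfps) = CHAR('k)"
proof (rule CHAR_eq_if_injective_hom [of mfps_const])
  show "inj (mfps_const :: 'k \<Rightarrow> ('k, 'n) mfps)"
    by (rule injI) (metis mfps_const.rep_eq)
qed (simp_all add: mfps_const_1 mfps_const_add)

lemma of_mfps_eq_iff: "of_mfps f = of_mfps g \<longleftrightarrow> f = g"
  by (simp add: of_mfps_def eq_fract)

lemma of_mfps_0: "of_mfps 0 = 0"
  by (simp add: of_mfps_def Zero_fract_def)

lemma of_mfps_eq_0_iff: "of_mfps f = 0 \<longleftrightarrow> f = 0"
  by (simp add: of_mfps_eq_iff flip: of_mfps_0)

lemma of_mfps_sum: "of_mfps (sum F S) = (\<Sum>x\<in>S. of_mfps (F x))"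
  by (induction S rule: infinite_finite_induct) (simp_all add: of_mfps_add of_mfps_0)

lemma of_mfps_power: "of_mfps (f ^ n) = of_mfps f ^ n"
  by (induction n) (simp_all add: of_mfps_mult of_mfps_1)

lemma CHAR_mfps_frac [simp]: "CHAR(('k::idom, 'n::finite) mfps_frac) = CHAR('k)"
proof -
  have "CHAR(('k, 'n) mfps_frac) = CHAR(('k, 'n) mfps)"
    by (rule CHAR_eq_if_injective_hom [of of_mfps])
      (auto simp: of_mfps_1 of_mfps_add inj_def of_mfps_eq_iff)
  then show ?thesis
    by simp
qed

text \<open>The \<open>p\<close>-th power map is not obviously compatible with infinite sums; for a single coefficient
  only a truncation of the series matters, and the truncation is a finite sum.\<close>

lemma mfps_nth_power_CHAR:
  fixes h :: "('k::comm_ring_1, 'n::finite) mfps"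
  assumes p: "prime CHAR('k)"
  shows "mfps_nth (h ^ CHAR('k)) m = (if \<forall>s. CHAR('k) dvd m $ s
    then mfps_nth h (\<chi> s. m $ s div CHAR('k)) ^ CHAR('k) else 0)"
proof -
  let ?p = "CHAR('k)"
  have p0: "?p > 0"
    using p by (simp add: prime_gt_0_nat)
  \<comment> \<open>\<open>B\<close> holds the exponents that can occur in a factor of t^m;
    \<open>u\<close> is the truncation of \<open>h\<close> to them and \<open>v\<close> the
    remainder.\<close>
  define B where "B = {i :: nat ^ 'n. \<forall>s. i $ s \<le> m $ s}"
  have "B \<subseteq> fst ` {(i, j). i + j = m}"
  proof
    fix i assume "i \<in> B"
    then have "i + (m - i) = m"
      by (simp add: B_def vec_eq_iff)
    then show "i \<in> fst ` {(i, j). i + j = m}"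
      by force
  qed
  then have fin: "finite B"
    by (rule finite_subset) (intro finite_imageI finite_add_decomp)
  define u where "u = (\<Sum>i\<in>B. mfps_single i (mfps_nth h i))"
  define v where "v = h - u"
  have v: "mfps_nth v i = 0" if "i \<in> B" for i
  proof -
    have "mfps_nth u i = mfps_nth h i"
      using that fin by (simp add: u_def mfps_nth_sum mfps_nth_single)
    then show ?thesis
      by (simp add: v_def minus_mfps.rep_eq)
  qed
  \<comment> \<open>Each summand of this coefficient contains a coefficient of \<open>v\<close> at
    an exponent in \<open>B\<close>.\<close>
  have "mfps_nth (v ^ n * v) m = 0" for n
    unfolding times_mfps.rep_eq by (rule sum.neutral) (auto simp: B_def v)
  then have vp: "mfps_nth (v ^ ?p) m = 0"
    using p0 by (metis Suc_pred power_Suc2)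
  have "h ^ ?p = (u + v) ^ ?p"
    by (simp add: v_def)
  also have "\<dots> = u ^ ?p + v ^ ?p"
    using p by (intro freshmans_dream) simp_all
  finally have "mfps_nth (h ^ ?p) m = mfps_nth (u ^ ?p) m"
    by (simp add: mfps_nth_add vp)
  also have "u ^ ?p = (\<Sum>i\<in>B. mfps_single i (mfps_nth h i) ^ ?p)"
    unfolding u_def using p by (intro freshmans_dream_sum) simp_all
  also have "mfps_nth \<dots> m = (\<Sum>i\<in>B. if m = (\<chi> s. ?p * i $ s) then mfps_nth h i ^ ?p else 0)"
    by (simp add: mfps_nth_sum mfps_single_power mfps_nth_single)
  also have "\<dots> = (\<Sum>i\<in>(if \<forall>s. ?p dvd m $ s then {\<chi> s. m $ s div ?p} else {}). mfps_nth h i ^ ?p)"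
    by (rule sum.mono_neutral_cong_right [OF fin])
      (use p0 in \<open>auto simp: B_def vec_eq_iff split: if_splits\<close>)
  finally show ?thesis
    by simp
qed

section \<open>Uniqueness of expansions over p-th powers\<close>

lemma finite_digits: "finite (digits p :: (nat ^ 'n::finite) set)"
proof -
  have "digits p \<subseteq> (\<lambda>i. \<chi> s. i s) ` (PiE (UNIV :: 'n set) (\<lambda>s. {..<p}))"
  proof
    fix r :: "nat ^ 'n" assume "r \<in> digits p"
    then show "r \<in> (\<lambda>i. \<chi> s. i s) ` (PiE (UNIV :: 'n set) (\<lambda>s. {..<p}))"
      by (intro image_eqI [of _ _ "($) r"]) (auto simp: vec_eq_iff digits_def)
  qed
  then show ?thesis
    by (rule finite_subset) (intro finite_imageI finite_PiE; simp)
qed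

text \<open>The exponents occurring in t^r h_r^p are all congruent to r modulo p, so different
  digits r cannot cancel each other.\<close>

lemma mfps_frob_independent:
  fixes h :: "nat ^ 'n::finite \<Rightarrow> ('k::idom, 'n) mfps"
  assumes p: "prime CHAR('k)"
    and 0: "(\<Sum>r\<in>digits CHAR('k). mfps_monom r * h r ^ CHAR('k)) = 0"
    and r: "r \<in> digits CHAR('k)"
  shows "h r = 0"
proof (rule mfps_eqI)
  fix i
  let ?p = "CHAR('k)"
  \<comment> \<open>Only the summand of index \<open>r\<close> has a coefficient here, and it is the
    p-th power of the coefficient of \<open>h r\<close> at \<open>i\<close>.\<close>
  define m where "m = (\<chi> s. ?p * i $ s + r $ s)"
  have p0: "?p > 0"
    using p by (simp add: prime_gt_0_nat)
  have coeff: "mfps_nth (mfps_monom r' * h r' ^ ?p) m = (if r' = r then mfps_nth (h r) i ^ ?p else 0)"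
    if r': "r' \<in> digits ?p" for r'
  proof (cases "r' = r")
    case True
    then have "m - r' = (\<chi> s. ?p * i $ s)"
      by (simp add: m_def vec_eq_iff)
    then show ?thesis
      using p p0 True by (simp add: mfps_monom_eq_single mfps_nth_single_mult mfps_nth_power_CHAR m_def)
  next
    case False
    then obtain s where s: "r' $ s \<noteq> r $ s"
      by (auto simp: vec_eq_iff)
    have "\<not> ?p dvd m $ s - r' $ s" if "r' $ s \<le> m $ s"
    proof
      assume "?p dvd m $ s - r' $ s"
      then have "m $ s mod ?p = r' $ s mod ?p"
        using that by (metis mod_eq_dvd_iff_nat)
      then show False
        using r r' s by (auto simp: m_def digits_def)
    qed
    then show ?thesis
      using False p by (auto simp: mfps_monom_eq_single mfps_nth_single_mult mfps_nth_power_CHAR)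
  qed
  have "0 = mfps_nth (\<Sum>r\<in>digits ?p. mfps_monom r * h r ^ ?p) m"
    by (simp add: 0 mfps_nth_0)
  also have "\<dots> = (\<Sum>r'\<in>digits ?p. if r' = r then mfps_nth (h r) i ^ ?p else 0)"
    unfolding mfps_nth_sum by (rule sum.cong [OF refl coeff])
  also have "\<dots> = mfps_nth (h r) i ^ ?p"
    using r by (simp add: finite_digits)
  finally show "mfps_nth (h r) i = mfps_nth 0 i"
    by (simp add: mfps_nth_0)
qed

lemma common_denominator:
  fixes z :: "'i \<Rightarrow> ('k::idom, 'n::finite) mfps_frac"
  assumes "finite S"
  shows "\<exists>d h. d \<noteq> 0 \<and> (\<forall>i\<in>S. of_mfps d * z i = of_mfps (h i))"
  using assms
proof induction
  case empty
  show ?case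
    by (auto intro: exI [of _ 1])
next
  case (insert i S)
  then obtain d h where d: "d \<noteq> 0" "\<And>j. j \<in> S \<Longrightarrow> of_mfps d * z j = of_mfps (h j)"
    by blast
  obtain a b where ab: "z i = Fract a b" "b \<noteq> 0"
    by (cases "z i") auto
  have "of_mfps (d * b) * z j = of_mfps (if j = i then d * a else b * h j)" if "j \<in> insert i S" for j
  proof (cases "j = i")
    case True
    then show ?thesis
      using ab by (simp add: of_mfps_def eq_fract)
  next
    case False
    then have "of_mfps b * (of_mfps d * z j) = of_mfps b * of_mfps (h j)"
      using d that by simp
    then show ?thesis
      using False by (simp add: of_mfps_mult mult_ac)
  qed
  moreover have "d * b \<noteq> 0"
    using d ab by simp
  ultimately show ?case
    by (intro exI conjI ballI)
qed

text \<open>Multiplying the relation by d^p for a common denominator d keeps its shape, since d^p is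
  itself a p-th power, and moves it into k[[t]].\<close>

lemma frob_independent:
  fixes z :: "nat ^ 'n::finite \<Rightarrow> ('k::idom, 'n) mfps_frac"
  assumes p: "prime CHAR('k)"
    and 0: "(\<Sum>r\<in>digits CHAR('k). of_mfps (mfps_monom r) * z r ^ CHAR('k)) = 0"
    and r: "r \<in> digits CHAR('k)"
  shows "z r = 0"
proof -
  let ?p = "CHAR('k)"
  obtain d h where d: "d \<noteq> 0" "\<And>j. j \<in> digits ?p \<Longrightarrow> of_mfps d * z j = of_mfps (h j)"
    using common_denominator [OF finite_digits [of ?p], of z] by blast
  have "of_mfps (\<Sum>r\<in>digits ?p. mfps_monom r * h r ^ ?p) =
      (\<Sum>r\<in>digits ?p. of_mfps (mfps_monom r) * (of_mfps d * z r) ^ ?p)"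
    by (simp add: of_mfps_sum of_mfps_mult of_mfps_power d)
  also have "\<dots> = of_mfps d ^ ?p * (\<Sum>r\<in>digits ?p. of_mfps (mfps_monom r) * z r ^ ?p)"
    by (simp add: power_mult_distrib sum_distrib_left mult_ac)
  finally have "(\<Sum>r\<in>digits ?p. mfps_monom r * h r ^ ?p) = 0"
    by (simp add: 0 of_mfps_eq_0_iff)
  then have "h r = 0"
    using mfps_frob_independent p r by blast
  then have "of_mfps d * z r = 0"
    using d(2) [OF r] by (simp add: of_mfps_0)
  then show ?thesis
    using d(1) by (simp add: of_mfps_eq_0_iff)
qed

lemma frob_unique:
  fixes z w :: "nat ^ 'n::finite \<Rightarrow> ('k::idom, 'n) mfps_frac"
  assumes p: "prime CHAR('k)"
    and eq: "(\<Sum>r\<in>digits CHAR('k). of_mfps (mfps_monom r) * z r ^ CHAR('k)) =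
      (\<Sum>r\<in>digits CHAR('k). of_mfps (mfps_monom r) * w r ^ CHAR('k))"
    and r: "r \<in> digits CHAR('k)"
  shows "z r = w r"
proof -
  have "z r ^ CHAR('k) = (z r - w r) ^ CHAR('k) + w r ^ CHAR('k)" for r
    using p by (subst freshmans_dream [symmetric]) simp_all
  then have "(\<Sum>r\<in>digits CHAR('k). of_mfps (mfps_monom r) * (z r - w r) ^ CHAR('k)) = 0"
    using eq by (simp add: algebra_simps sum.distrib)
  then show ?thesis
    using frob_independent [OF p, of "\<lambda>r. z r - w r"] r by simp
qed

lemma inj_frob:
  assumes p: "prime CHAR('k::field)"
  shows "inj (frob :: ('k, 'n::finite) mfps_frac \<Rightarrow> _)"
proof (rule injI)
  fix x y :: "('k, 'n) mfps_frac"
  assume "frob x = frob y"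
  moreover have "frob x = (x - y) ^ CHAR('k) + frob y"
    unfolding frob_def using p by (subst freshmans_dream [symmetric]) simp_all
  ultimately show "x = y"
    by simp
qed

text \<open>Evaluates the definite description behind the sections: an explicit expansion of
  \<open>g\<close> satisfies it, and \<open>frob_unique\<close> excludes any other.\<close>

lemma section_op_eqI:
  fixes g :: "('k::field, 'n::finite) mfps_frac"
  assumes p: "prime CHAR('k)"
    and g: "g = (\<Sum>r\<in>digits CHAR('k). of_mfps (mfps_monom r) * z r ^ CHAR('k))"
    and r: "r \<in> digits CHAR('k)"
  shows "section_op r g = z r"
proof -
  have "frob_coords g = (\<lambda>r. if r \<in> digits CHAR('k) then frob (z r) else 0)"
    unfolding frob_coords_def
  proof (rule the_equality)
    fix G assume G: "(\<forall>r\<in>digits CHAR('k). G r \<in> range frob) \<and>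
      (\<forall>r. r \<notin> digits CHAR('k) \<longrightarrow> G r = 0) \<and>
      g = (\<Sum>r\<in>digits CHAR('k). of_mfps (mfps_monom r) * G r)"
    then have "\<forall>r\<in>digits CHAR('k). \<exists>w. G r = frob w"
      by blast
    then obtain w where w: "\<And>r. r \<in> digits CHAR('k) \<Longrightarrow> G r = frob (w r)"
      by metis
    then have "g = (\<Sum>r\<in>digits CHAR('k). of_mfps (mfps_monom r) * w r ^ CHAR('k))"
      using G by (simp add: frob_def)
    then have "w r = z r" if "r \<in> digits CHAR('k)" for r
      using frob_unique [OF p _ that, of w z] g by simp
    then show "G = (\<lambda>r. if r \<in> digits CHAR('k) then frob (z r) else 0)"
      using G w by auto
  qed (auto simp: g frob_def)
  then show ?thesis
    using r by (simp add: section_op_def inv_f_f [OF inj_frob [OF p]])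
qed

section \<open>Residue coefficients and Hasse derivatives\<close>

text \<open>H^p has coefficients only at multiples of p, and p m - 1 is congruent to p - 1. Hence
  the factor (c + X)^s, of degree at most p - 1, can contribute only through its coefficient of
  index p - 1, which is 1 for s = p - 1 and 0 otherwise.\<close>

lemma fps_nth_shifted_power_mult_power_CHAR:
  fixes c :: "'a::comm_ring_1" and H :: "'a fps"
  assumes p: "prime CHAR('a)" and s: "s < CHAR('a)" and m: "m > 0"
  shows "fps_nth ((fps_const c + fps_X) ^ s * H ^ CHAR('a)) (CHAR('a) * m - 1) =
    (if s = CHAR('a) - 1 then fps_nth H (m - 1) ^ CHAR('a) else 0)"
proof -
  let ?p = "CHAR('a)"
  let ?Y = "(fps_const c + fps_X) ^ s"
  have p0: "?p > 0"
    using p by (simp add: prime_gt_0_nat)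
  obtain k where k: "m = Suc k"
    using m by (cases m) simp_all
  have eq: "?p * m - 1 = ?p * k + (?p - 1)"
    using p0 by (simp add: k)
  have zero: "fps_nth ?Y i * fps_nth (H ^ ?p) (?p * m - 1 - i) = 0"
    if i: "i \<le> ?p * m - 1" "i \<noteq> ?p - 1" for i
  proof (cases "i \<le> s")
    case True
    then have "?p * m - 1 - i = ?p * k + (?p - 1 - i)"
      using s eq by simp
    moreover have "\<not> ?p dvd ?p - 1 - i"
      using True i s p0 by (intro nat_dvd_not_less) auto
    ultimately have "\<not> ?p dvd ?p * m - 1 - i"
      by (metis dvd_add_right_iff dvd_triv_left)
    then show ?thesis
      using p by (simp add: fps_nth_power_CHAR)
  next
    case False
    then show ?thesis
      by (simp add: fps_nth_shifted_power binomial_eq_0)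
  qed
  have "fps_nth (?Y * H ^ ?p) (?p * m - 1) =
      (\<Sum>i = 0..?p * m - 1. fps_nth ?Y i * fps_nth (H ^ ?p) (?p * m - 1 - i))"
    by (rule fps_mult_nth)
  also have "\<dots> = (\<Sum>i\<in>{?p - 1}. fps_nth ?Y i * fps_nth (H ^ ?p) (?p * m - 1 - i))"
    by (rule sum.mono_neutral_right) (use eq zero in auto)
  also have "\<dots> = fps_nth ?Y (?p - 1) * fps_nth H (m - 1) ^ ?p"
    using p p0 unfolding eq by (simp add: k fps_nth_power_CHAR)
  also have "fps_nth ?Y (?p - 1) = (if s = ?p - 1 then 1 else 0)"
    using s by (auto simp: fps_nth_shifted_power binomial_eq_0)
  finally show ?thesis
    by simp
qed

text \<open>The binomial factor stands for the q-th derivative divided by q!, a division that is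
  impossible in characteristic p once q is at least p.\<close>

definition fps_hasse :: "nat \<Rightarrow> 'a::comm_ring_1 fps \<Rightarrow> 'a fps"
  where "fps_hasse q F = Abs_fps (\<lambda>n. of_nat ((n + q) choose q) * fps_nth F (n + q))"

lemma fps_hasse_nth: "fps_nth (fps_hasse q F) n = of_nat ((n + q) choose q) * fps_nth F (n + q)"
  by (simp add: fps_hasse_def)

lemma fps_hasse_sum: "fps_hasse q (sum F S) = (\<Sum>x\<in>S. fps_hasse q (F x))"
  by (rule fps_ext) (simp add: fps_hasse_nth fps_sum_nth sum_distrib_left)

lemma fps_hasse_const_mult: "fps_hasse q (fps_const c * F) = fps_const c * fps_hasse q F"
  by (rule fps_ext) (simp add: fps_hasse_nth mult_ac)

text \<open>The Hasse derivative commutes with the translation by \<open>c\<close>. Multiplying back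
  by (c + X)^q makes the operator diagonal on the powers of c + X, so with y = c + X it creates no
  new monomials in y.\<close>

lemma shifted_power_mult_fps_hasse:
  "(fps_const c + fps_X) ^ q * fps_hasse q ((fps_const c + fps_X) ^ j) =
    fps_const (of_nat (j choose q)) * (fps_const c + fps_X) ^ j"
proof (cases "q \<le> j")
  case True
  have "fps_hasse q ((fps_const c + fps_X) ^ j) =
      fps_const (of_nat (j choose q)) * (fps_const c + fps_X) ^ (j - q)"
  proof (rule fps_ext)
    fix n
    show "fps_nth (fps_hasse q ((fps_const c + fps_X) ^ j)) n =
      fps_nth (fps_const (of_nat (j choose q)) * (fps_const c + fps_X) ^ (j - q)) n"
    proof (cases "n + q \<le> j")
      case le: True
      have "((n + q) choose q) * (j choose (n + q)) = (j choose q) * ((j - q) choose n)"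
        using choose_mult [of q "n + q" j] le by (simp add: mult.commute)
      then have "(of_nat ((n + q) choose q) :: 'a) * of_nat (j choose (n + q)) =
          of_nat (j choose q) * of_nat ((j - q) choose n)"
        by (metis of_nat_mult)
      then show ?thesis
        by (simp add: fps_hasse_nth fps_nth_shifted_power add.commute [of q n] flip: mult.assoc)
    next
      case False
      then have "j - q < n"
        using True by linarith
      with False show ?thesis
        by (simp add: fps_hasse_nth fps_nth_shifted_power binomial_eq_0)
    qed
  qed
  then show ?thesis
    using True by (simp add: mult.left_commute flip: power_add)
next
  case False
  then have "fps_hasse q ((fps_const c + fps_X) ^ j) = 0"
    by (intro fps_ext) (simp add: fps_hasse_nth fps_nth_shifted_power binomial_eq_0)
  then show ?thesis
    using False by (simp add: binomial_eq_0)
qed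

section \<open>The k-space K[[T]] and the lattice points\<close>

definition lscale :: "'k::field \<Rightarrow> ('k, 'n::finite) mfps_frac fps \<Rightarrow> ('k, 'n) mfps_frac fps"
  where "lscale c x = fps_const (of_mfps (mfps_const c)) * x"

interpretation lspace: vector_space "lscale :: 'k::field \<Rightarrow> ('k, 'n::finite) mfps_frac fps \<Rightarrow> _"
proof
  fix a b :: 'k and x y :: "('k, 'n) mfps_frac fps"
  show "lscale a (x + y) = lscale a x + lscale a y"
    by (simp only: lscale_def distrib_left)
  show "lscale (a + b) x = lscale a x + lscale b x"
    by (simp only: lscale_def mfps_const_add of_mfps_add distrib_right flip: fps_const_add)
  show "lscale a (lscale b x) = lscale (a * b) x"
    by (simp only: lscale_def mfps_const_mult of_mfps_mult mult.assoc flip: fps_const_mult)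
  show "lscale 1 x = x"
    by (simp only: lscale_def mfps_const_1 of_mfps_1 mult_1_left fps_const_1_eq_1)
qed

interpretation lk: vector_space_pair
  "lscale :: 'k::field \<Rightarrow> ('k, 'n::finite) mfps_frac fps \<Rightarrow> _"
  "kscale :: 'k \<Rightarrow> ('k, 'n) mfps_frac \<Rightarrow> _" ..

lemma mult_lscale: "x * lscale c z = lscale c (x * z)"
  by (simp add: lscale_def mult.left_commute)

lemma fps_hasse_lscale: "fps_hasse q (lscale c x) = lscale c (fps_hasse q x)"
  by (simp add: lscale_def fps_hasse_const_mult)

lemma of_mfps_of_nat: "of_mfps (mfps_const (of_nat n)) = of_nat n"
proof (induction n)
  case 0
  have "mfps_const 0 = (0 :: ('a, 'b) mfps)"
    by (rule mfps_eqI) (simp add: mfps_const.rep_eq mfps_nth_0)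
  then show ?case
    by (simp add: of_mfps_0)
qed (simp add: mfps_const_add mfps_const_1 of_mfps_add of_mfps_1)

definition emb :: "(nat ^ 'n::finite) \<times> nat \<Rightarrow> (real ^ 'n) \<times> real"
  where "emb d = ((\<chi> s. real (fst d $ s)), real (snd d))"

lemma emb_add: "emb (a + b) = emb a + emb b"
  by (simp add: emb_def prod_eq_iff vec_eq_iff)

lemma inj_emb: "inj emb"
  by (rule injI) (auto simp: emb_def prod_eq_iff vec_eq_iff)

lemma range_emb: "range emb = nat_points"
proof
  show "range emb \<subseteq> nat_points"
    by (auto simp: emb_def nat_points_def)
  show "nat_points \<subseteq> range emb"
  proof
    fix x assume x: "x \<in> nat_points"
    then have "\<forall>s. \<exists>k. fst x $ s = real k"
      by (auto simp: nat_points_def Nats_def)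
    then obtain k where "\<And>s. fst x $ s = real (k s)"
      by metis
    moreover obtain j where "snd x = real j"
      using x by (auto simp: nat_points_def Nats_def)
    ultimately have "x = emb ((\<chi> s. k s), j)"
      by (simp add: emb_def prod_eq_iff vec_eq_iff)
    then show "x \<in> range emb"
      by blast
  qed
qed

section \<open>Expansion of A around the root\<close>

locale algebraic_mfps =
  fixes A :: "('k::field, 'n::finite) mpoly_y" and f :: "('k, 'n) mfps"
  assumes CHAR_pos: "CHAR('k) > 0"
    and perfect: "surj (\<lambda>x::'k. x ^ CHAR('k))"
    and A_nonzero: "A \<noteq> 0"
    and root: "eval_y A f = 0"
begin

definition y :: "('k, 'n) mfps_frac fps"
  where "y = fps_const (of_mfps f) + fps_X"

abbreviation expansion :: "(nat ^ 'n \<Rightarrow> nat \<Rightarrow> ('k, 'n) mfps_frac fps) \<Rightarrow> ('k, 'n) mfps_frac fps"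
  where "expansion G \<equiv> (\<Sum>r\<in>digits CHAR('k). \<Sum>s<CHAR('k).
    fps_const (of_mfps (mfps_monom r)) * y ^ s * G r s ^ CHAR('k))"

definition mon :: "(nat ^ 'n) \<times> nat \<Rightarrow> ('k, 'n) mfps_frac fps"
  where "mon d = fps_const (of_mfps (mfps_monom (fst d))) * y ^ snd d"

text \<open>\<open>AT = A(t, f + T)\<close>, and \<open>rho x\<close> is the residue of \<open>x / AT\<close> at \<open>T = 0\<close>.\<close>

definition AT :: "('k, 'n) mfps_frac fps"
  where "AT = (\<Sum>d\<in>Poly_Mapping.keys A. lscale (Poly_Mapping.lookup A d) (mon d))"

definition root_mult :: nat
  where "root_mult = subdegree AT"

text \<open>\<open>AT\<close> is T^m times this unit, where m is \<open>root_mult\<close>. Residues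
  of quotients by \<open>AT\<close> thereby become coefficients of index m - 1 of power
  series.\<close>

definition U :: "('k, 'n) mfps_frac fps"
  where "U = fps_shift root_mult AT"

definition rho :: "('k, 'n) mfps_frac fps \<Rightarrow> ('k, 'n) mfps_frac"
  where "rho x = fps_nth (x * inverse U) (root_mult - 1)"

definition D :: "((nat ^ 'n) \<times> nat) set"
  where "D = {d. emb d \<in> newton_polytope A + half_open_cube}"

definition W :: "('k, 'n) mfps_frac set"
  where "W = rho ` lspace.span (mon ` D)"

lemma prime_p: "prime CHAR('k)"
  using CHAR_pos by (rule prime_CHAR_semidom)

lemma mon_add: "mon (a + b) = mon a * mon b"
  by (simp add: mon_def mfps_monom_add of_mfps_mult power_add mult_ac flip: fps_const_mult)

text \<open>Substituting f + T for y is composition with a polynomial of degree one, hence injective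
  on K[y]. It remains to see that A stays nonzero in K[y].\<close>

lemma AT_nonzero: "AT \<noteq> 0"
proof -
  define P :: "('k, 'n) mfps_frac poly" where
    "P = (\<Sum>d\<in>Poly_Mapping.keys A.
      monom (of_mfps (mfps_single (fst d) (Poly_Mapping.lookup A d))) (snd d))"
  obtain i j where ij: "(i, j) \<in> Poly_Mapping.keys A"
    using A_nonzero by (metis all_not_in_conv keys_eq_empty surj_pair)
  \<comment> \<open>The coefficient of y^j in \<open>P\<close>; its own coefficient at t^i is that
    of A at (i, j).\<close>
  define a where "a = (\<Sum>d\<in>Poly_Mapping.keys A.
      if snd d = j then mfps_single (fst d) (Poly_Mapping.lookup A d) else 0)"
  have "coeff P j = of_mfps a"
    by (simp add: P_def a_def coeff_sum of_mfps_sum if_distrib of_mfps_0 cong: if_cong)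
  moreover have "mfps_nth a i = (\<Sum>d\<in>Poly_Mapping.keys A.
      if d = (i, j) then Poly_Mapping.lookup A d else 0)"
    unfolding a_def mfps_nth_sum by (rule sum.cong) (auto simp: mfps_nth_single mfps_nth_0)
  then have "mfps_nth a i = Poly_Mapping.lookup A (i, j)"
    using ij by simp
  then have "a \<noteq> 0"
    using ij by (metis in_keys_iff mfps_nth_0)
  ultimately have "P \<noteq> 0"
    by (metis coeff_0 of_mfps_eq_0_iff)
  then have "pcompose P [:of_mfps f, 1:] \<noteq> 0"
    by (simp add: pcompose_eq_0_iff)
  moreover have "fps_of_poly (pcompose P [:of_mfps f, 1:]) = AT"
  proof -
    have "pcompose (monom c n) [:of_mfps f, 1:] = [:c:] * [:of_mfps f, 1:] ^ n"
      for c :: "('k, 'n) mfps_frac" and n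
      by (simp add: pcompose_altdef map_poly_monom poly_monom)
    moreover have "fps_of_poly [:of_mfps f, 1:] = y"
      by (simp add: y_def fps_of_poly_pCons)
    ultimately show ?thesis
      by (simp add: P_def AT_def pcompose_sum fps_of_poly_sum fps_of_poly_smult fps_of_poly_power
          fps_of_poly_const lscale_def mon_def of_mfps_mult flip: mfps_const_mult_monom mult.assoc)
  qed
  ultimately show ?thesis
    by (metis fps_of_poly_0 fps_of_poly_eq_iff)
qed

lemma AT_nth_0: "fps_nth AT 0 = 0"
proof -
  have "fps_nth AT 0 = of_mfps (eval_y A f)"
    by (simp add: AT_def eval_y_def fps_sum_nth lscale_def mon_def y_def case_prod_unfold
        of_mfps_sum of_mfps_mult of_mfps_power mult.assoc fps_power_zeroth)
  then show ?thesis
    by (simp add: root of_mfps_0)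
qed

lemma root_mult_pos: "root_mult > 0"
  using AT_nonzero AT_nth_0 unfolding root_mult_def by (metis gr0I nth_subdegree_nonzero)

lemma AT_eq: "AT = fps_X ^ root_mult * U"
  unfolding U_def root_mult_def by (subst mult.commute) (rule subdegree_decompose)

lemma U_inverse: "U * inverse U = 1"
proof -
  have "fps_nth U 0 \<noteq> 0"
    using AT_nonzero by (simp add: U_def root_mult_def)
  then show ?thesis
    by (simp add: inverse_mult_eq_1')
qed

lemma rho_linear: "Vector_Spaces.linear lscale kscale rho"
  by unfold_locales (simp_all add: rho_def lscale_def kscale_def distrib_right mult.assoc)

lemma W_eq_span: "W = kspace.span ((\<lambda>d. rho (mon d)) ` D)"
  unfolding W_def by (simp add: lk.linear_span_image [OF rho_linear, symmetric] image_image)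

section \<open>Lattice points of C and supports\<close>

lemma newton_polytope_eq: "newton_polytope A = convex hull (emb ` Poly_Mapping.keys A)"
  by (simp add: newton_polytope_def emb_def [abs_def] case_prod_unfold)

lemma finite_D: "finite D"
proof -
  have "bounded (newton_polytope A)"
    unfolding newton_polytope_eq by (intro bounded_convex_hull finite_imp_bounded) simp
  then obtain B where B: "\<And>x. x \<in> newton_polytope A \<Longrightarrow> norm x \<le> B"
    by (auto simp: bounded_iff)
  \<comment> \<open>The cube has no positive coordinates, so \<open>B\<close> bounds the coordinates
    of points of \<open>D\<close>; the added 1 makes the bound strict.\<close>
  define K where "K = nat \<lceil>B\<rceil> + 1"
  have "D \<subseteq> digits K \<times> {..<K}"
  proof
    fix d assume "d \<in> D"
    then obtain b c where bc: "b \<in> newton_polytope A" "c \<in> half_open_cube" "emb d = b + c"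
      by (auto simp: D_def elim: set_plus_elim)
    have "real (fst d $ s) \<le> B" for s
    proof -
      have "real (fst d $ s) = fst b $ s + fst c $ s"
        using arg_cong [OF bc(3), of "\<lambda>x. fst x $ s"] by (simp add: emb_def)
      also have "fst c $ s \<le> 0"
        using bc(2) by (simp add: half_open_cube_def)
      also have "fst b $ s \<le> norm (fst b)"
        using component_le_norm_cart [of "fst b" s] by simp
      also have "\<dots> \<le> norm b"
        using norm_fst_le [of "fst b" "snd b"] by simp
      finally show ?thesis
        using B [OF bc(1)] by simp
    qed
    moreover have "real (snd d) \<le> B"
    proof -
      have "real (snd d) = snd b + snd c"
        using arg_cong [OF bc(3), of snd] by (simp add: emb_def)
      also have "snd c \<le> 0"
        using bc(2) by (simp add: half_open_cube_def)
      also have "snd b \<le> norm b"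
        using norm_snd_le [of "snd b" "fst b"] by simp
      finally show ?thesis
        using B [OF bc(1)] by simp
    qed
    moreover have "l < K" if "real l \<le> B" for l
      using that real_nat_ceiling_ge [of B] unfolding K_def by linarith
    ultimately have "fst d \<in> digits K" "snd d < K"
      by (simp_all add: digits_def)
    then show "d \<in> digits K \<times> {..<K}"
      by (cases d) simp
  qed
  then show ?thesis
    by (rule finite_subset) (simp add: finite_digits)
qed

lemma card_D: "card D = card ((newton_polytope A + half_open_cube) \<inter> nat_points)"
proof -
  have "(newton_polytope A + half_open_cube) \<inter> nat_points = emb ` D"
    unfolding range_emb [symmetric] D_def by blast
  then show ?thesis
    by (simp add: card_image inj_on_subset [OF inj_emb])
qed

text \<open>Lying in a span of elements \<open>mon d\<close> plays the role of having a given
  support. By bilinearity, the fact that supports add under multiplication reduces to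
  \<open>mon_add\<close>.\<close>

lemma span_mon_mult:
  assumes "x \<in> lspace.span (mon ` S)" "z \<in> lspace.span (mon ` S')"
    and "\<And>a b. a \<in> S \<Longrightarrow> b \<in> S' \<Longrightarrow> a + b \<in> S''"
  shows "x * z \<in> lspace.span (mon ` S'')"
proof -
  have *: "mon a * z \<in> lspace.span (mon ` S'')" if "a \<in> S" for a
    using assms(2)
  proof (induction rule: lspace.span_induct_alt)
    case base
    show ?case
      by (simp add: lspace.span_zero)
  next
    case (step c u v)
    then obtain b where "b \<in> S'" "u = mon b"
      by blast
    then have "mon a * u \<in> lspace.span (mon ` S'')"
      using assms(3) [OF that] by (simp add: lspace.span_base flip: mon_add)
    moreover have "mon a * (lscale c u + v) = lscale c (mon a * u) + mon a * v"
      by (simp add: lscale_def algebra_simps)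
    ultimately show ?case
      using step by (simp add: lspace.span_add lspace.span_scale)
  qed
  show ?thesis
    using assms(1)
  proof (induction rule: lspace.span_induct_alt)
    case base
    show ?case
      by (simp add: lspace.span_zero)
  next
    case (step c u v)
    moreover have "(lscale c u + v) * z = lscale c (u * z) + v * z"
      by (simp add: lscale_def algebra_simps)
    ultimately show ?case
      using * by (auto intro!: lspace.span_add lspace.span_scale)
  qed
qed

text \<open>Convexity in the form NP + n NP = (n + 1) NP; the witness is the weighted mean of the
  two points.\<close>

lemma newton_polytope_average:
  assumes "a \<in> newton_polytope A" "b \<in> newton_polytope A"
  shows "\<exists>c\<in>newton_polytope A. a + real n *\<^sub>R b = real (Suc n) *\<^sub>R c"
proof
  show "(1 / real (Suc n)) *\<^sub>R a + (real n / real (Suc n)) *\<^sub>R b \<in> newton_polytope A"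
    using assms unfolding newton_polytope_eq
    by (intro convexD [OF convex_convex_hull]) (simp_all add: field_simps)
  show "a + real n *\<^sub>R b =
      real (Suc n) *\<^sub>R ((1 / real (Suc n)) *\<^sub>R a + (real n / real (Suc n)) *\<^sub>R b)"
    by (simp add: scaleR_add_right)
qed

lemma emb_keys: "d \<in> Poly_Mapping.keys A \<Longrightarrow> emb d \<in> newton_polytope A"
  unfolding newton_polytope_eq by (simp add: hull_inc)

lemma AT_in_span: "AT \<in> lspace.span (mon ` Poly_Mapping.keys A)"
  unfolding AT_def by (intro lspace.span_sum lspace.span_scale lspace.span_base imageI)

lemma AT_power_in_span:
  "AT ^ n \<in> lspace.span (mon ` {d. \<exists>b\<in>newton_polytope A. emb d = real n *\<^sub>R b})"
proof (induction n)
  case 0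
  \<comment> \<open>For n = 0 some point of the polytope must be available to be scaled by
    0.\<close>
  have "newton_polytope A \<noteq> {}"
    using A_nonzero unfolding newton_polytope_eq by simp
  moreover have "emb 0 = 0"
    by (simp add: emb_def prod_eq_iff vec_eq_iff)
  moreover have "mon 0 = 1"
    by (simp add: mon_def mfps_monom_def of_mfps_1)
  ultimately show ?case
    by (auto intro!: lspace.span_base image_eqI [of _ _ 0])
next
  case (Suc n)
  show ?case
    unfolding power_Suc
  proof (rule span_mon_mult [OF AT_in_span Suc])
    fix a d assume a: "a \<in> Poly_Mapping.keys A"
      and "d \<in> {d. \<exists>b\<in>newton_polytope A. emb d = real n *\<^sub>R b}"
    then obtain b where "b \<in> newton_polytope A" "emb d = real n *\<^sub>R b"
      by blast
    then show "a + d \<in> {d. \<exists>b\<in>newton_polytope A. emb d = real (Suc n) *\<^sub>R b}"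
      using newton_polytope_average [OF emb_keys [OF a], of b n] unfolding mem_Collect_eq emb_add
      by metis
  qed
qed

text \<open>Dividing by p gives (i, j) = b + (c - (r, s)) / p. Each coordinate of c lies in (-1, 0]
  and each digit in [0, p - 1], so the difference lies in (-p, 0] and the quotient is again in the
  cube.\<close>

lemma D_section:
  assumes b: "b \<in> newton_polytope A" and c: "c \<in> half_open_cube"
    and eq: "emb ((\<chi> v. CHAR('k) * i $ v + r $ v), CHAR('k) * j + s) = real CHAR('k) *\<^sub>R b + c"
    and r: "r \<in> digits CHAR('k)" and s: "s < CHAR('k)"
  shows "(i, j) \<in> D"
proof -
  have cube: "(x - real l) / real CHAR('k) \<in> {-1<..0}" if "x \<in> {-1<..0}" "l < CHAR('k)" for x l
  proof -
    have "real l \<le> real CHAR('k) - 1"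
      using that by linarith
    then have "- real CHAR('k) < x - real l" "x - real l \<le> 0"
      using that by auto
    then show ?thesis
      using CHAR_pos by (simp add: field_simps)
  qed
  define c' where "c' = (1 / real CHAR('k)) *\<^sub>R (c - emb (r, s))"
  have "c' \<in> half_open_cube"
    using c r s cube by (simp add: half_open_cube_def c'_def emb_def digits_def)
  moreover have "emb (i, j) = b + c'"
  proof -
    have "emb ((\<chi> v. CHAR('k) * i $ v + r $ v), CHAR('k) * j + s) =
        real CHAR('k) *\<^sub>R emb (i, j) + emb (r, s)"
      by (simp add: emb_def prod_eq_iff vec_eq_iff)
    then have "real CHAR('k) *\<^sub>R emb (i, j) = real CHAR('k) *\<^sub>R b + (c - emb (r, s))"
      using eq by (simp add: algebra_simps)
    then have "(1 / real CHAR('k)) *\<^sub>R real CHAR('k) *\<^sub>R emb (i, j) =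
        (1 / real CHAR('k)) *\<^sub>R (real CHAR('k) *\<^sub>R b + (c - emb (r, s)))"
      by simp
    then show ?thesis
      using CHAR_pos by (simp add: c'_def scaleR_add_right)
  qed
  ultimately show ?thesis
    using b by (auto simp: D_def)
qed

section \<open>Sections of polynomials and of residues\<close>

text \<open>For one term, division of the exponents by p with remainder gives the expansion;
  additivity of the p-th power lets expansions of sums be added coordinatewise.\<close>

lemma span_mon_sections:
  assumes "x \<in> lspace.span (mon ` S)"
  shows "\<exists>G. (\<forall>r\<in>digits CHAR('k). \<forall>s<CHAR('k).
        G r s \<in> lspace.span (mon ` {(i, j). ((\<chi> v. CHAR('k) * i $ v + r $ v), CHAR('k) * j + s) \<in> S})) \<and>
      x = expansion G"
  using assms
proof (induction rule: lspace.span_induct_alt)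
  case base
  show ?case
    using CHAR_pos by (intro exI [of _ "\<lambda>_ _. 0"]) (simp add: lspace.span_zero power_0_left)
next
  case (step c u x)
  then obtain G where
    G: "\<And>r s. r \<in> digits CHAR('k) \<Longrightarrow> s < CHAR('k) \<Longrightarrow>
      G r s \<in> lspace.span (mon ` {(i, j). ((\<chi> v. CHAR('k) * i $ v + r $ v), CHAR('k) * j + s) \<in> S})"
    and x: "x = expansion G"
    by blast
  obtain d where d: "d \<in> S" "u = mon d"
    using step by blast
  \<comment> \<open>Perfectness of k lets the scalar enter the p-th power.\<close>
  obtain b where c: "c = b ^ CHAR('k)"
    using perfect by (metis surjD)
  define i where "i = (\<chi> v. fst d $ v div CHAR('k))"
  define r where "r = (\<chi> v. fst d $ v mod CHAR('k))"
  define j where "j = snd d div CHAR('k)"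
  define s where "s = snd d mod CHAR('k)"
  have d_eq: "d = ((\<chi> v. CHAR('k) * i $ v + r $ v), CHAR('k) * j + s)"
    by (simp add: prod_eq_iff vec_eq_iff i_def r_def j_def s_def)
  have rs: "r \<in> digits CHAR('k)" "s < CHAR('k)"
    using CHAR_pos by (simp_all add: digits_def r_def s_def)
  have monom: "mfps_monom (\<chi> v. CHAR('k) * i $ v + r $ v) =
      mfps_monom i ^ CHAR('k) * (mfps_monom r :: ('k, 'n) mfps)"
  proof -
    have "(\<chi> v. CHAR('k) * i $ v) + r = (\<chi> v. CHAR('k) * i $ v + r $ v)"
      by (simp add: vec_eq_iff)
    then show ?thesis
      by (simp add: mfps_monom_eq_single mfps_single_power mfps_single_mult)
  qed
  have const: "of_mfps (mfps_const (b ^ n)) = of_mfps (mfps_const b) ^ n" for n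
    by (induction n) (simp_all add: mfps_const_1 of_mfps_1 mfps_const_mult of_mfps_mult)
  have u: "lscale c u = fps_const (of_mfps (mfps_monom r)) * y ^ s * lscale b (mon (i, j)) ^ CHAR('k)"
    by (simp add: d d_eq c lscale_def mon_def monom const of_mfps_mult of_mfps_power power_mult_distrib
        power_add power_mult [symmetric] mult_ac fps_const_power flip: fps_const_mult)
  \<comment> \<open>The coordinates of the single term \<open>lscale c u\<close>, concentrated at
    its own remainders.\<close>
  define E where "E r' s' = (if r' = r \<and> s' = s then lscale b (mon (i, j)) else 0)" for r' s'
  have sum_E: "expansion E = lscale c u"
  proof -
    have "(\<Sum>s'<CHAR('k). fps_const (of_mfps (mfps_monom r')) * y ^ s' * E r' s' ^ CHAR('k)) =
        (if r' = r then lscale c u else 0)" for r' :: "nat ^ 'n"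
    proof -
      have "fps_const (of_mfps (mfps_monom r')) * y ^ s' * E r' s' ^ CHAR('k) =
          (if s' = s then if r' = r then lscale c u else 0 else 0)" for s'
        using CHAR_pos by (simp add: E_def u power_0_left)
      then show ?thesis
        using rs by simp
    qed
    then show ?thesis
      using rs by (simp add: finite_digits)
  qed
  show ?case
  proof (intro exI [of _ "\<lambda>r s. G r s + E r s"] conjI ballI allI impI)
    fix r' :: "nat ^ 'n" and s' assume rs': "r' \<in> digits CHAR('k)" "s' < CHAR('k)"
    have "E r' s' \<in> lspace.span (mon ` {(i, j). ((\<chi> v. CHAR('k) * i $ v + r' $ v), CHAR('k) * j + s') \<in> S})"
    proof (cases "r' = r \<and> s' = s")
      case True
      then show ?thesis
        using d(1) d_eq by (auto simp: E_def intro!: lspace.span_scale [OF lspace.span_base])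
    qed (auto simp: E_def lspace.span_zero)
    then show "G r' s' + E r' s' \<in>
        lspace.span (mon ` {(i, j). ((\<chi> v. CHAR('k) * i $ v + r' $ v), CHAR('k) * j + s') \<in> S})"
      using G [OF rs'] by (rule lspace.span_add [rotated])
  next
    have "(G r s + E r s) ^ CHAR('k) = G r s ^ CHAR('k) + E r s ^ CHAR('k)" for r s
      using prime_p by (intro freshmans_dream) simp_all
    then show "lscale c u + x = expansion (\<lambda>r s. G r s + E r s)"
      by (simp add: distrib_left sum.distrib sum_E x add.commute)
  qed
qed

text \<open>The factor AT^(p - 1) rewrites x / AT with denominator AT^p. It enlarges the support
  only to points of p NP(A) plus the cube, which \<open>D_section\<close> brings back to
  \<open>D\<close>.\<close>

lemma span_D_sections:
  assumes "x \<in> lspace.span (mon ` D)"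
  shows "\<exists>G. (\<forall>r\<in>digits CHAR('k). \<forall>s<CHAR('k). G r s \<in> lspace.span (mon ` D)) \<and>
    x * AT ^ (CHAR('k) - 1) = expansion G"
proof -
  define S where "S = {d. \<exists>b\<in>newton_polytope A. \<exists>c\<in>half_open_cube. emb d = real CHAR('k) *\<^sub>R b + c}"
  have "x * AT ^ (CHAR('k) - 1) \<in> lspace.span (mon ` S)"
  proof (rule span_mon_mult [OF assms AT_power_in_span])
    fix d d' assume "d \<in> D" and "d' \<in> {d. \<exists>b\<in>newton_polytope A. emb d = real (CHAR('k) - 1) *\<^sub>R b}"
    then obtain a b c where abc: "a \<in> newton_polytope A" "b \<in> newton_polytope A" "c \<in> half_open_cube"
      "emb d = a + c" "emb d' = real (CHAR('k) - 1) *\<^sub>R b"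
      by (auto simp: D_def elim: set_plus_elim)
    obtain b' where "b' \<in> newton_polytope A" "a + real (CHAR('k) - 1) *\<^sub>R b = real CHAR('k) *\<^sub>R b'"
      using newton_polytope_average [OF abc(1,2), of "CHAR('k) - 1"] CHAR_pos by auto
    moreover have "emb (d + d') = a + real (CHAR('k) - 1) *\<^sub>R b + c"
      by (simp add: emb_add abc)
    ultimately show "d + d' \<in> S"
      using abc(3) by (auto simp: S_def)
  qed
  then obtain G where G: "\<And>r s. r \<in> digits CHAR('k) \<Longrightarrow> s < CHAR('k) \<Longrightarrow>
        G r s \<in> lspace.span (mon ` {(i, j). ((\<chi> v. CHAR('k) * i $ v + r $ v), CHAR('k) * j + s) \<in> S})"
    and eq: "x * AT ^ (CHAR('k) - 1) = expansion G"
    using span_mon_sections by blast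
  have "G r s \<in> lspace.span (mon ` D)" if rs: "r \<in> digits CHAR('k)" "s < CHAR('k)" for r s
  proof -
    have "{(i, j). ((\<chi> v. CHAR('k) * i $ v + r $ v), CHAR('k) * j + s) \<in> S} \<subseteq> D"
      using rs D_section by (auto simp: S_def)
    then show ?thesis
      using G [OF rs] lspace.span_mono [OF image_mono] by blast
  qed
  with eq show ?thesis
    by blast
qed

text \<open>With denominator AT^p the pole order is p m, which explains the index p m - 1. The
  factor y^n covers both uses: n = 0 for the sections, and n congruent to -1 modulo p for extracting
  roots.\<close>

lemma rho_sections:
  assumes "x * AT ^ (CHAR('k) - 1) = expansion G"
  shows "rho (y ^ n * x) = (\<Sum>r\<in>digits CHAR('k). \<Sum>s<CHAR('k). of_mfps (mfps_monom r) *
      fps_nth (y ^ (s + n) * (G r s * inverse U) ^ CHAR('k)) (CHAR('k) * root_mult - 1))"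
proof -
  have p_eq: "CHAR('k) = Suc (CHAR('k) - 1)"
    using CHAR_pos by simp
  \<comment> \<open>The powers of U cancel except for one inverse, leaving the shift by T^(m (p -
    1)).\<close>
  have "AT ^ (CHAR('k) - 1) * inverse U ^ CHAR('k) =
      fps_X ^ (root_mult * (CHAR('k) - 1)) *
      (U * inverse U) ^ (CHAR('k) - 1) * inverse U"
    by (subst p_eq, subst power_Suc) (simp add: AT_eq power_mult_distrib power_mult mult_ac)
  then have "fps_X ^ (root_mult * (CHAR('k) - 1)) * (y ^ n * x * inverse U) =
      y ^ n * (x * AT ^ (CHAR('k) - 1)) * inverse U ^ CHAR('k)"
    by (simp add: U_inverse mult_ac)
  also have "\<dots> = (\<Sum>r\<in>digits CHAR('k). \<Sum>s<CHAR('k). fps_const (of_mfps (mfps_monom r)) *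
      (y ^ (s + n) * (G r s * inverse U) ^ CHAR('k)))"
    by (simp only: assms sum_distrib_left sum_distrib_right)
      (intro sum.cong refl, simp add: power_mult_distrib power_add mult_ac)
  finally have "fps_nth (fps_X ^ (root_mult * (CHAR('k) - 1)) * (y ^ n * x * inverse U))
      (CHAR('k) * root_mult - 1) =
      (\<Sum>r\<in>digits CHAR('k). \<Sum>s<CHAR('k). of_mfps (mfps_monom r) *
        fps_nth (y ^ (s + n) * (G r s * inverse U) ^ CHAR('k)) (CHAR('k) * root_mult - 1))"
    by (simp add: fps_sum_nth)
  moreover have "CHAR('k) * root_mult - 1 = root_mult * (CHAR('k) - 1) + (root_mult - 1)"
    by (subst (1) p_eq) (use root_mult_pos in \<open>simp add: algebra_simps\<close>)
  ultimately show ?thesis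
    by (simp add: rho_def fps_X_power_mult_nth)
qed

lemma y_power_nth:
  "s < CHAR('k) \<Longrightarrow> fps_nth (y ^ s * H ^ CHAR('k)) (CHAR('k) * root_mult - 1) =
    (if s = CHAR('k) - 1 then fps_nth H (root_mult - 1) ^ CHAR('k) else 0)"
  using fps_nth_shifted_power_mult_power_CHAR [of s root_mult "of_mfps f" H] prime_p root_mult_pos
  by (simp add: y_def)

text \<open>Only s = p - 1 has a residue, so taking residues commutes with taking sections.\<close>

lemma rho_eq_sections:
  assumes "x * AT ^ (CHAR('k) - 1) = expansion G"
  shows "rho x = (\<Sum>r\<in>digits CHAR('k). of_mfps (mfps_monom r) * rho (G r (CHAR('k) - 1)) ^ CHAR('k))"
proof -
  have "rho x = (\<Sum>r\<in>digits CHAR('k). \<Sum>s<CHAR('k). of_mfps (mfps_monom r) *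
      (if s = CHAR('k) - 1 then rho (G r s) ^ CHAR('k) else 0))"
    using rho_sections [OF assms, of 0]
    by (simp add: y_power_nth rho_def del: One_nat_def cong: if_cong)
  then show ?thesis
    using CHAR_pos by (simp add: if_distrib cong: if_cong)
qed

text \<open>The factor y^(p n) goes into the p-th power, while y^(p - 1) rotates the digit s: now s
  = 0 is the one with a residue, and s = t + 1 becomes t < p - 1 after a carry, with none.\<close>

lemma rho_y_power_sections:
  assumes "x * AT ^ (CHAR('k) - 1) = expansion G"
  shows "rho (y ^ (CHAR('k) * n + (CHAR('k) - 1)) * x) =
      (\<Sum>r\<in>digits CHAR('k). of_mfps (mfps_monom r) * rho (y ^ n * G r 0) ^ CHAR('k))"
proof -
  have "fps_nth (y ^ (s + (CHAR('k) * n + (CHAR('k) - 1))) * (G r s * inverse U) ^ CHAR('k))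
      (CHAR('k) * root_mult - 1) = (if s = 0 then rho (y ^ n * G r 0) ^ CHAR('k) else 0)" if s: "s < CHAR('k)" for r s
  proof (cases s)
    case 0
    have "y ^ (s + (CHAR('k) * n + (CHAR('k) - 1))) * (G r s * inverse U) ^ CHAR('k) =
        y ^ (CHAR('k) - 1) * (y ^ n * G r 0 * inverse U) ^ CHAR('k)"
      by (simp add: 0 power_mult_distrib power_add mult_ac flip: power_mult)
    then show ?thesis
      using 0 CHAR_pos by (simp add: y_power_nth rho_def del: One_nat_def)
  next
    case (Suc t)
    have eq: "s + (CHAR('k) * n + (CHAR('k) - 1)) = t + n * CHAR('k) + CHAR('k)"
      using Suc CHAR_pos by simp
    then have "y ^ (s + (CHAR('k) * n + (CHAR('k) - 1))) * (G r s * inverse U) ^ CHAR('k) =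
        y ^ t * (y ^ n * y * G r s * inverse U) ^ CHAR('k)"
      by (simp only: eq) (simp add: power_mult_distrib power_add power_mult mult_ac)
    then show ?thesis
      using Suc s by (simp add: y_power_nth del: One_nat_def)
  qed
  then have "rho (y ^ (CHAR('k) * n + (CHAR('k) - 1)) * x) =
      (\<Sum>r\<in>digits CHAR('k). \<Sum>s<CHAR('k). of_mfps (mfps_monom r) *
        (if s = 0 then rho (y ^ n * G r 0) ^ CHAR('k) else 0))"
    using rho_sections [OF assms, of "CHAR('k) * n + (CHAR('k) - 1)"] by simp
  then show ?thesis
    using CHAR_pos by (simp add: if_distrib cong: if_cong)
qed

section \<open>Stability of W and membership of f\<close>

lemma section_op_W:
  assumes "r \<in> digits CHAR('k)" "w \<in> W"
  shows "section_op r w \<in> W"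
proof -
  obtain x where x: "x \<in> lspace.span (mon ` D)" "w = rho x"
    using assms by (auto simp: W_def)
  obtain G where G: "\<And>r s. r \<in> digits CHAR('k) \<Longrightarrow> s < CHAR('k) \<Longrightarrow> G r s \<in> lspace.span (mon ` D)"
    and eq: "x * AT ^ (CHAR('k) - 1) = expansion G"
    using span_D_sections [OF x(1)] by blast
  have "section_op r w = rho (G r (CHAR('k) - 1))"
    by (rule section_op_eqI [OF prime_p _ assms(1)]) (simp add: x(2) rho_eq_sections [OF eq])
  then show ?thesis
    using G [OF assms(1)] CHAR_pos by (auto simp: W_def)
qed

text \<open>Descent on e. Since p^(e + 1) - 1 = p (p^e - 1) + (p - 1),
  \<open>rho_y_power_sections\<close> expands z^(p^(e + 1)) over p-th powers; comparing the
  coordinates at r = 0 gives the same relation for e with \<open>G 0 0\<close> in place of x. At e =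
  0 it reads rho x = z.\<close>

lemma root_of_residue_in_W:
  assumes "x \<in> lspace.span (mon ` D)" "rho (y ^ (CHAR('k) ^ e - 1) * x) = z ^ (CHAR('k) ^ e)"
  shows "z \<in> W"
  using assms
proof (induction e arbitrary: x)
  case 0
  then show ?case
    by (auto simp: W_def)
next
  case (Suc e)
  obtain G where
    G: "\<And>r s. r \<in> digits CHAR('k) \<Longrightarrow> s < CHAR('k) \<Longrightarrow> G r s \<in> lspace.span (mon ` D)"
    and eq: "x * AT ^ (CHAR('k) - 1) = expansion G"
    using span_D_sections [OF Suc.prems(1)] by blast
  have zero: "(0 :: nat ^ 'n) \<in> digits CHAR('k)"
    using CHAR_pos by (simp add: digits_def)
  have "CHAR('k) ^ e > 0"
    using CHAR_pos by simp
  then obtain l where l: "CHAR('k) ^ e = Suc l"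
    by (metis not0_implies_Suc not_gr0)
  have "CHAR('k) ^ Suc e - 1 = CHAR('k) * (CHAR('k) ^ e - 1) + (CHAR('k) - 1)"
    using CHAR_pos by (simp add: l algebra_simps)
  then have "(\<Sum>r\<in>digits CHAR('k). of_mfps (mfps_monom r) * rho (y ^ (CHAR('k) ^ e - 1) * G r 0) ^ CHAR('k)) =
      z ^ CHAR('k) ^ Suc e"
    using Suc.prems(2) rho_y_power_sections [OF eq, of "CHAR('k) ^ e - 1"] by simp
  \<comment> \<open>The right-hand side is a p-th power already, so its expansion sits at r = 0
    alone and can be compared by \<open>frob_unique\<close>.\<close>
  also have "\<dots> = (\<Sum>r\<in>{0}. of_mfps (mfps_monom r) *
      (if r = 0 then z ^ CHAR('k) ^ e else 0) ^ CHAR('k))"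
    by (simp add: mfps_monom_def of_mfps_1 flip: power_mult) (simp add: mult.commute)
  also have "\<dots> = (\<Sum>r\<in>digits CHAR('k). of_mfps (mfps_monom r) *
      (if r = 0 then z ^ CHAR('k) ^ e else 0) ^ CHAR('k))"
    by (rule sum.mono_neutral_left) (use zero CHAR_pos in \<open>auto simp: finite_digits power_0_left\<close>)
  finally have "rho (y ^ (CHAR('k) ^ e - 1) * G 0 0) = z ^ CHAR('k) ^ e"
    using frob_unique [OF prime_p _ zero, of "\<lambda>r. rho (y ^ (CHAR('k) ^ e - 1) * G r 0)"
        "\<lambda>r. if r = 0 then z ^ CHAR('k) ^ e else 0"] by simp
  then show ?case
    using Suc.IH G [OF zero CHAR_pos] by blast
qed

text \<open>Modulo T^m the Hasse derivative of T^m U of order q is m' T^(m - q) U, so U cancels in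
  the residue. What remains is m' times the coefficient of T^(q - 1) in y^(2q - 1), namely m'
  f^q.\<close>

lemma f_in_W: "of_mfps f \<in> W"
proof -
  obtain m' where m': "root_mult = CHAR('k) ^ multiplicity CHAR('k) root_mult * m'" "\<not> CHAR('k) dvd m'"
    using multiplicity_decompose' [of root_mult "CHAR('k)"] root_mult_pos prime_p
    by (metis not_prime_unit neq0_conv)
  define e where "e = multiplicity CHAR('k) root_mult"
  define q where "q = CHAR('k) ^ e"
  have q: "q > 0"
    using CHAR_pos by (simp add: q_def)
  have root_mult_eq: "root_mult = q * m'"
    using m' by (simp add: q_def e_def)
  then have q_le: "q \<le> root_mult"
    using root_mult_pos by (cases m') auto
  \<comment> \<open>m' is prime to p, hence invertible in k; dividing by it makes the residue
    exactly f^q.\<close>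
  define x where "x = lscale (inverse (of_nat m')) (y ^ q * fps_hasse q AT)"
  have "y ^ q * fps_hasse q (mon d) = lscale (of_nat (snd d choose q)) (mon d)" for d
    using shifted_power_mult_fps_hasse [of "of_mfps f" q "snd d"]
    by (simp add: mon_def y_def fps_hasse_const_mult lscale_def of_mfps_of_nat mult_ac)
  then have "y ^ q * fps_hasse q AT =
      (\<Sum>d\<in>Poly_Mapping.keys A. lscale (Poly_Mapping.lookup A d) (lscale (of_nat (snd d choose q)) (mon d)))"
    by (simp add: AT_def fps_hasse_sum fps_hasse_lscale sum_distrib_left mult_lscale)
  moreover have "Poly_Mapping.keys A \<subseteq> D"
  proof
    fix d assume "d \<in> Poly_Mapping.keys A"
    then have "emb d + 0 \<in> newton_polytope A + half_open_cube"
      by (intro set_plus_intro emb_keys) (simp_all add: half_open_cube_def)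
    then show "d \<in> D"
      by (simp add: D_def)
  qed
  ultimately have x: "x \<in> lspace.span (mon ` D)"
    by (simp only: x_def) (intro lspace.span_scale lspace.span_sum lspace.span_base imageI; blast)
  \<comment> \<open>In this range n + q < m + q. Below m the coefficients of \<open>AT\<close>
    vanish; from m on, (n + q) div q is constantly m', and so is the binomial coefficient in
    K.\<close>
  have nth: "fps_nth (fps_hasse q AT) n = fps_nth (fps_const (of_nat m') * (fps_X ^ (root_mult - q) * U)) n"
    if n: "n < root_mult" for n
  proof (cases "n < root_mult - q")
    case True
    then show ?thesis
      by (simp add: fps_hasse_nth AT_eq fps_X_power_mult_nth)
  next
    case False
    have "(n + q) div q = m'"
      by (rule div_nat_eqI) (use False n q_le in \<open>simp_all add: root_mult_eq algebra_simps\<close>)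
    then have "of_nat ((n + q) choose q) = (of_nat m' :: ('k, 'n) mfps_frac)"
      using of_nat_choose_CHAR_power [where ?'a = "('k, 'n) mfps_frac", of "n + q" e] prime_p
      by (simp add: q_def)
    then show ?thesis
      using False q_le by (simp add: fps_hasse_nth AT_eq fps_X_power_mult_nth)
  qed
  have "rho (y ^ (q - 1) * (y ^ q * fps_hasse q AT)) =
      fps_nth (fps_hasse q AT * (y ^ (q - 1) * y ^ q * inverse U)) (root_mult - 1)"
    by (simp add: rho_def mult_ac)
  \<comment> \<open>The coefficient of index m - 1 sees only coefficients of index below m, so the
    congruence modulo T^m suffices.\<close>
  also have "\<dots> = fps_nth ((fps_const (of_nat m') * (fps_X ^ (root_mult - q) * U)) *
      (y ^ (q - 1) * y ^ q * inverse U)) (root_mult - 1)"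
    unfolding fps_mult_nth [of _ "y ^ (q - 1) * y ^ q * inverse U"]
    by (rule sum.cong) (use nth root_mult_pos in auto)
  also have "(fps_const (of_nat m') * (fps_X ^ (root_mult - q) * U)) * (y ^ (q - 1) * y ^ q * inverse U) =
      fps_const (of_nat m') * (fps_X ^ (root_mult - q) * (y ^ (q - 1) * y ^ q)) * (U * inverse U)"
    by (simp only: mult_ac)
  also have "fps_nth \<dots> (root_mult - 1) = of_nat m' * fps_nth (y ^ (q - 1) * y ^ q) (q - 1)"
    using q q_le by (simp add: U_inverse mult.assoc fps_X_power_mult_nth)
  also have "fps_nth (y ^ (q - 1) * y ^ q) (q - 1) = of_mfps f ^ q"
  proof -
    \<comment> \<open>As q is a power of p, y^q = f^q + T^q. The term T^q is too high to matter, and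
      the top coefficient of y^(q - 1) is 1.\<close>
    have "y ^ q = fps_const (of_mfps f ^ q) + fps_X ^ q"
      unfolding y_def using prime_p freshmans_dream' [of q e "fps_const (of_mfps f)" fps_X]
      by (simp add: q_def fps_const_power)
    then have "y ^ (q - 1) * y ^ q =
        y ^ (q - 1) * fps_const (of_mfps f ^ q) + y ^ (q - 1) * fps_X ^ q"
      by (simp only: distrib_left)
    moreover have "fps_nth (y ^ (q - 1)) (q - 1) = 1"
      by (simp only: y_def fps_nth_shifted_power) simp
    ultimately show ?thesis
      using q by (simp add: fps_X_power_mult_right_nth)
  qed
  finally have "rho (y ^ (q - 1) * (y ^ q * fps_hasse q AT)) = of_nat m' * of_mfps f ^ q" .
  moreover have "y ^ (q - 1) * x = lscale (inverse (of_nat m')) (y ^ (q - 1) * (y ^ q * fps_hasse q AT))"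
    by (simp add: x_def mult_lscale)
  ultimately have "rho (y ^ (q - 1) * x) = kscale (inverse (of_nat m')) (of_nat m' * of_mfps f ^ q)"
    using lk.linear_scale [OF rho_linear] by simp
  also have "\<dots> = kscale (inverse (of_nat m')) (kscale (of_nat m') (of_mfps f ^ q))"
    by (simp add: kscale_def of_mfps_of_nat)
  also have "\<dots> = of_mfps f ^ q"
    using m'(2) by (simp add: of_nat_eq_0_iff_char_dvd)
  finally show ?thesis
    using root_of_residue_in_W [OF x, of e] by (simp add: q_def)
qed

end

section \<open>Dimension bound and stability under the monoid\<close>

theorem theorem1p2:
  fixes A :: "('k::field, 'n::finite) mpoly_y" and f :: "('k, 'n) mfps"
    and C :: "((real ^ 'n) \<times> real) set"
  assumes "CHAR('k) > 0" and "surj (\<lambda>x::'k. x ^ CHAR('k))"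
    and "A \<noteq> 0" and "eval_y A f = 0"
  defines "C \<equiv> newton_polytope A + half_open_cube"
  shows "\<exists>W :: ('k, 'n) mfps_frac set.
           kspace.subspace W \<and>
           (\<exists>B. finite B \<and> kspace.span B = W) \<and>
           kspace.dim W \<le> card (C \<inter> nat_points) \<and>
           of_mfps f \<in> W \<and>
           (\<forall>\<phi>\<in>section_monoid. \<phi> ` W \<subseteq> W)"
proof -
  interpret algebraic_mfps A f
    by unfold_locales fact+
  let ?B = "(\<lambda>d. rho (mon d)) ` D"
  have B: "finite ?B"
    by (simp add: finite_D)
  \<comment> \<open>The residues of the monomials indexed by \<open>D\<close> span W but may
    coincide or be dependent, whence only an inequality.\<close>
  have "kspace.dim W \<le> card ?B"
    unfolding W_eq_span using B by (intro kspace.dim_le_card) simp_all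
  also have "\<dots> \<le> card (C \<inter> nat_points)"
    unfolding C_def card_D [symmetric] by (rule card_image_le [OF finite_D])
  finally have "kspace.dim W \<le> card (C \<inter> nat_points)" .
  moreover have "\<phi> ` W \<subseteq> W" if "\<phi> \<in> section_monoid" for \<phi>
    using that by induction (auto intro: section_op_W)
  moreover have "kspace.subspace W"
    unfolding W_eq_span by simp
  ultimately show ?thesis
    using B W_eq_span f_in_W by blast
qed

end
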